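(* For every real $\xi>0$ there exists $N$ such that for all integers $n\ge N$ and all integers $k$ with $1\le k\leq n^{0.25}$ the following holds: if $\mathcal{F}\subset \mathrm{Sym}(n,k)$ is a non-centred intersecting family, then \[|\mathcal{F}| \leq \left(\frac{2}{3} +\xi\right)\cdot \max\left\{ \mathrm{c}(n-1,k),\ \mathrm{c}(n-1,k-1) \right\}.\]
   Context: $[n]=\{1,\dots,n\}$; $\mathrm{Sym}(n)$ is the set of all permutations of $[n]$. $\mathrm{Sym}(n,k)$ is the set of permutations in $\mathrm{Sym}(n)$ with exactly $k$ cycles in their cycle decomposition (fixed points count as cycles). $\mathrm{c}(m,l)$ is the unsigned Stirling number of the first kind, i.e. the number of permutations of $[m]$ with exactly $l$ cycles; in particular $\mathrm{c}(m,0)=0$ for $m>0$. A family $\mathcal{F}\subset\mathrm{Sym}(n,k)$ is intersecting if for all $\sigma,\tau\in\mathcal{F}$ there is $i\in[n]$ with $\sigma(i)=\tau(i)$. A star in $\mathrm{Sym}(n,k)$ is a family of the form $\{\sigma\in\mathrm{Sym}(n,k): \sigma(i)=j\}$ with $i,j\in[n]$. An intersecting family is centred if it is contained in a star, and non-centred otherwise. *)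

theory Defs
  imports Complex_Main "HOL-Combinatorics.Combinatorics"
begin

text \<open>A cycle is represented by its support; a fixed point contributes a singleton orbit.\<close>

definition cycles_on :: "nat \<Rightarrow> (nat \<Rightarrow> nat) \<Rightarrow> nat set set" where
  "cycles_on n \<sigma> = orbit \<sigma> ` {1..n}"

definition Sym :: "nat \<Rightarrow> nat \<Rightarrow> (nat \<Rightarrow> nat) set" where
  "Sym n k = {\<sigma>. \<sigma> permutes {1..n} \<and> card (cycles_on n \<sigma>) = k}"

definition intersecting :: "nat \<Rightarrow> (nat \<Rightarrow> nat) set \<Rightarrow> bool" where
  "intersecting n \<F> \<longleftrightarrow> (\<forall>\<sigma>\<in>\<F>. \<forall>\<tau>\<in>\<F>. \<exists>i\<in>{1..n}. \<sigma> i = \<tau> i)"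

definition star :: "nat \<Rightarrow> nat \<Rightarrow> nat \<Rightarrow> nat \<Rightarrow> (nat \<Rightarrow> nat) set" where
  "star n k i j = {\<sigma> \<in> Sym n k. \<sigma> i = j}"

definition centred :: "nat \<Rightarrow> nat \<Rightarrow> (nat \<Rightarrow> nat) set \<Rightarrow> bool" where
  "centred n k \<F> \<longleftrightarrow> (\<exists>i\<in>{1..n}. \<exists>j\<in>{1..n}. \<F> \<subseteq> star n k i j)"

text \<open>
  The library defines \<^const>\<open>stirling\<close> by its recurrence. The lemmas below show that
  \<^term>\<open>stirling n k\<close> is the number of permutations of \<^term>\<open>{1..n}\<close> with exactly
  \<^term>\<open>k\<close> cycles.
\<close>

lemma orbit_transpose_comp:
  assumes p: "p permutes S" and S: "finite S" "a \<notin> S" and b: "b \<in> S" and y: "y \<in> S"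
  shows "orbit (transpose a b \<circ> p) y =
    (if b \<in> orbit p y then insert a (orbit p y) else orbit p y)"
proof -
  let ?q = "transpose a b \<circ> p"
  have ab: "a \<noteq> b" using S b by auto
  have pa: "p a = a" using p S by (simp add: permutes_not_in)
  have qa: "?q a = b" by (simp add: pa)
  have qb: "?q z = a" if "p z = b" for z using that by simp
  have q: "?q z = p z" if "p z \<noteq> b" "p z \<noteq> a" for z
    using that by (simp add: transpose_def)
  have orbS: "orbit p y \<subseteq> S"
  proof
    fix z assume "z \<in> orbit p y" then show "z \<in> S"
      by induct (use p y in \<open>auto simp: permutes_in_image\<close>)
  qed
  have na: "a \<notin> orbit p y" using orbS S by auto
  show ?thesis
  proof (cases "b \<in> orbit p y")
    case True
    have 1: "z \<in> orbit p y \<union> {a}" if "z \<in> orbit ?q y" for z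
      using that
    proof induct
      case base
      show ?case using orbit.base[of p y] by (auto simp: transpose_def True)
    next
      case (step z)
      then show ?case using orbit.step[of z p y] True
        by (cases "z = a") (auto simp: transpose_def pa)
    qed
    have 2: "z \<in> orbit ?q y" if "z \<in> orbit p y" for z
      using that
    proof induct
      case base
      have "p y \<noteq> a" using na orbit.base by metis
      then show ?case
        using q[of y] qb[of y] qa orbit.base[of ?q y] orbit.step[of _ ?q y] by metis
    next
      case (step z)
      have "p z \<noteq> a" using na orbit.step[OF step(1)] by metis
      then show ?case
        using q[of z] qb[of z] qa step(2) orbit.step[of _ ?q y] by metis
    qed
    have 3: "a \<in> orbit ?q y"
      using True
    proof cases
      case base
      then show ?thesis using qb[of y] orbit.base[of ?q y] by metis
    next
      case (step z)
      then show ?thesis using qb[of z] 2[of z] orbit.step[of z ?q y] by metis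
    qed
    show ?thesis using True 1 2 3 by auto
  next
    case False
    have q': "?q z = p z" if "p z \<in> orbit p y" for z
      using that False na by (intro q) auto
    have 1: "z \<in> orbit p y" if "z \<in> orbit ?q y" for z
      using that
    proof induct
      case base then show ?case using q'[of y] orbit.base[of p y] by metis
    next
      case (step z) then show ?case using q'[of z] orbit.step[of z p y] by metis
    qed
    have 2: "z \<in> orbit ?q y" if "z \<in> orbit p y" for z
      using that
    proof induct
      case base then show ?case using q'[of y] orbit.base[of p y] orbit.base[of ?q y] by metis
    next
      case (step z)
      then show ?case using q'[of z] orbit.step[of z p y] orbit.step[of z ?q y] by metis
    qed
    show ?thesis using False 1 2 by auto
  qed
qed

lemma orbit_subset_permutes:
  assumes "p permutes S" "y \<in> S" shows "orbit p y \<subseteq> S"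
proof
  fix z assume "z \<in> orbit p y" then show "z \<in> S"
    by induct (use assms in \<open>auto simp: permutes_in_image\<close>)
qed

lemma card_cycles_transpose:
  assumes p: "p permutes {1..n}" and b: "b \<in> {1..Suc n}"
  shows "card (cycles_on (Suc n) (transpose (Suc n) b \<circ> p)) =
    (if b = Suc n then Suc (card (cycles_on n p)) else card (cycles_on n p))"
proof (cases "b = Suc n")
  case True
  have "orbit p (Suc n) = {Suc n}"
    using p by (simp add: orbit_eq_singleton_iff permutes_not_in)
  moreover have "{Suc n} \<notin> orbit p ` {1..n}"
    using orbit_subset_permutes[OF p] by fastforce
  ultimately show ?thesis
    using True by (simp add: cycles_on_def atLeastAtMostSuc_conv comp_def)
next
  case False
  with b have b: "b \<in> {1..n}" by auto
  let ?q = "transpose (Suc n) b \<circ> p"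
  let ?g = "\<lambda>Z. if b \<in> Z then insert (Suc n) Z else Z"
  have o: "orbit ?q y = ?g (orbit p y)" if "y \<in> {1..n}" for y
    using orbit_transpose_comp[OF p _ _ b that, of "Suc n"] by simp
  have "p permutes {1..Suc n}" using p by (rule permutes_subset) auto
  then have perm: "permutation ?q"
    using b by (intro permutation_compose permutation_swap_id) (auto simp: permutation_permutes)
  have "?q (Suc n) = b" using p by (simp add: permutes_not_in)
  then have "orbit ?q (Suc n) = orbit ?q b"
    using permutation_orbit_step[OF perm, of "Suc n"] by simp
  then have "cycles_on (Suc n) ?q = orbit ?q ` {1..n}"
    using b by (auto simp: cycles_on_def atLeastAtMostSuc_conv)
  also have "\<dots> = ?g ` cycles_on n p"
    unfolding cycles_on_def image_image using o by (intro image_cong) auto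
  finally have "cycles_on (Suc n) ?q = ?g ` cycles_on n p" .
  moreover have "inj_on ?g (cycles_on n p)"
  proof (rule inj_onI)
    fix X Y assume "X \<in> cycles_on n p" "Y \<in> cycles_on n p" and e: "?g X = ?g Y"
    then have "Suc n \<notin> X" "Suc n \<notin> Y"
      using orbit_subset_permutes[OF p] by (fastforce simp: cycles_on_def)+
    then show "X = Y" using e by (auto simp: insert_ident split: if_splits)
  qed
  ultimately have "card (cycles_on (Suc n) ?q) = card (cycles_on n p)"
    by (simp only: card_image)
  then show ?thesis using False by simp
qed

lemma finite_Sym: "finite (Sym n k)"
  unfolding Sym_def by (rule finite_subset[OF _ finite_permutations[of "{1..n}"]]) auto

lemma card_Sym_Suc:
  "card (Sym (Suc n) k) = n * card (Sym n k) + (if k = 0 then 0 else card (Sym n (k - 1)))"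
proof -
  let ?h = "\<lambda>(b, p). transpose (Suc n) b \<circ> p"
  let ?A = "{1..n} \<times> Sym n k" and ?B = "{Suc n} \<times> {p \<in> Sym n (k - 1). k \<noteq> 0}"
  have ins: "{1..Suc n} = insert (Suc n) {1..n}" by auto
  have inj: "inj_on ?h {(b, p). b \<in> {1..Suc n} \<and> p permutes {1..n}}"
  proof (rule inj_onI, clarify)
    fix b p c r assume pr: "p permutes {1..n}" "r permutes {1..n}"
      and e: "transpose (Suc n) b \<circ> p = transpose (Suc n) c \<circ> r"
    have "p (Suc n) = Suc n" "r (Suc n) = Suc n" using pr by (simp_all add: permutes_not_in)
    then have "b = c" using fun_cong[OF e, of "Suc n"] by simp
    moreover have "p = r"
      using e \<open>b = c\<close> by (metis comp_assoc id_comp transpose_comp_involutory)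
    ultimately show "b = c \<and> p = r" by simp
  qed
  have "Sym (Suc n) k = ?h ` (?A \<union> ?B)"
  proof (intro set_eqI iffI)
    fix q assume q: "q \<in> Sym (Suc n) k"
    then have "q \<in> {p. p permutes insert (Suc n) {1..n}}" using ins by (simp add: Sym_def)
    then obtain b p where bp: "b \<in> {1..Suc n}" "p permutes {1..n}" "q = transpose (Suc n) b \<circ> p"
      unfolding permutes_insert ins by auto
    have "(b, p) \<in> ?A \<union> ?B"
      using q bp card_cycles_transpose[OF bp(2,1)] by (auto simp: Sym_def split: if_splits)
    then show "q \<in> ?h ` (?A \<union> ?B)" using bp(3) by force
  next
    fix q assume "q \<in> ?h ` (?A \<union> ?B)"
    then obtain z where z: "q = ?h z" "z \<in> ?A \<union> ?B" by (rule imageE)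
    obtain b p where "z = (b, p)" by (cases z)
    with z have bp: "(b, p) \<in> ?A \<union> ?B" "q = transpose (Suc n) b \<circ> p" by simp_all
    then have b: "b \<in> {1..Suc n}" and p: "p permutes {1..n}" by (auto simp: Sym_def)
    have "q permutes {1..Suc n}"
      using permutes_insert[of "Suc n" "{1..n}"] ins b p bp(2) by auto
    then show "q \<in> Sym (Suc n) k"
      using bp card_cycles_transpose[OF p b] by (auto simp: Sym_def split: if_splits)
  qed
  moreover have "inj_on ?h (?A \<union> ?B)"
    by (rule inj_on_subset[OF inj]) (auto simp: Sym_def)
  ultimately have "card (Sym (Suc n) k) = card (?A \<union> ?B)" by (simp add: card_image)
  also have "\<dots> = card ?A + card ?B"
    by (rule card_Un_disjoint) (auto simp: finite_Sym)
  finally show ?thesis by (simp add: card_cartesian_product card_cartesian_product_singleton)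
qed

lemma Sym_0: "Sym 0 k = (if k = 0 then {id} else {})"
  by (auto simp: Sym_def cycles_on_def)

lemma stirling_eq_card_Sym: "stirling n k = card (Sym n k)"
proof (induction n k rule: stirling.induct)
  case (3 n)
  have "n = 0 \<or> card (Sym n 0) = 0"
  proof (cases n)
    case (Suc m)
    then have "Sym n 0 = {}" by (auto simp: Sym_def cycles_on_def)
    then show ?thesis by simp
  qed simp
  then show ?case by (auto simp: card_Sym_Suc)
qed (simp_all add: Sym_0 card_Sym_Suc)

end

theory Submission
  imports Defs "HOL-Library.FuncSet"
begin

text \<open>
  Permutations are identified with their graphs, sets of \<open>n\<close> pairs. Prescribing \<open>t\<close> pairs keeps at most
  a fraction \<open>(6k/n)^t\<close> of all permutations with \<open>k\<close> cycles, so for \<open>k\<close> up to \<open>n^(1/4)\<close> these are spread with a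
  parameter that exceeds the square root of \<open>n\<close> by a power of \<open>n\<close>. A spread approximation then covers an
  intersecting family, up to a negligible remainder, by cores of bounded size whose subfamilies are
  still spread. Two disjoint cores would have disjoint members: in a random colouring of the pairs with
  four colours, each of the two families has, with probability more than one half, a member that uses
  only its own two colours; this follows from two rounds of the minimal-fragment argument of Park and
  Pham. Hence the cores intersect. If they have no common pair, each contains one of boundedly
  many pairs of pairs and the family is negligible. Otherwise nearly all of it lies in a star, and all
  of that part meets a single permutation outside the star. The number of agreements with that
  permutation has factorial moments close to those of a Poisson variable with mean one, and
  Bonferroni's inequality of order three gives the factor \<open>1 - 1/2 + 1/6 = 2/3\<close>.
\<close>

section \<open>Minimal fragments of spread families\<close>

text \<open>This is the minimum fragment of Park and Pham: the cheapest completion of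
  \<open>W\<close> to a member of the family, among those available inside
  \<open>W \<union> A i\<close>. For \<open>i \<in> G\<close> the index \<open>i\<close> itself
  competes, so the minimum exists.\<close>

definition frag :: "'i set \<Rightarrow> ('i \<Rightarrow> 'a set) \<Rightarrow> 'a set \<Rightarrow> 'i \<Rightarrow> 'a set" where
  "frag G A W i = A (arg_min (\<lambda>j. card (A j - W)) (\<lambda>j. j \<in> G \<and> A j \<subseteq> W \<union> A i)) - W"

lemma frag_props:
  assumes "i \<in> G"
  obtains j where "j \<in> G" "A j \<subseteq> W \<union> A i" "frag G A W i = A j - W"
    "\<And>j'. j' \<in> G \<Longrightarrow> A j' \<subseteq> W \<union> A i \<Longrightarrow> card (frag G A W i) \<le> card (A j' - W)"
proof -
  let ?P = "\<lambda>j. j \<in> G \<and> A j \<subseteq> W \<union> A i"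
  have P: "?P i" using assms by auto
  show ?thesis
    using that[of "arg_min (\<lambda>j. card (A j - W)) ?P"]
      arg_min_natI[of ?P, OF P, of "\<lambda>j. card (A j - W)"]
      arg_min_nat_le[of ?P _ "\<lambda>j. card (A j - W)"]
    unfolding frag_def by blast
qed

lemma frag_subset:
  assumes "i \<in> G" shows "frag G A W i \<subseteq> A i - W"
  using frag_props[OF assms, of A W] by (metis Diff_subset_conv Un_Diff_cancel)

text \<open>
  Recolouring the fragment turns \<^term>\<open>c\<close> into a colouring whose marked set contains some member
  of the family; by minimality every fragment leading to the same recolouring lies inside that
  member, so there are few candidates for it.
\<close>

lemma card_large_fragments:
  fixes R K :: real
  assumes fin: "finite C" "finite I" and R: "R > 0" and K: "K \<ge> 0"
    and G: "\<And>c. c \<in> C \<Longrightarrow> G c \<subseteq> I"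
    and A: "\<And>c i. c \<in> C \<Longrightarrow> i \<in> G c \<Longrightarrow> A c i \<subseteq> U \<and> finite (A c i) \<and> card (A c i) \<le> s"
    and spread: "\<And>c Z. c \<in> C \<Longrightarrow> Z \<subseteq> U \<Longrightarrow> real (card {i \<in> G c. Z \<subseteq> A c i}) * R ^ card Z \<le> K"
    and recol: "\<And>c i T. c \<in> C \<Longrightarrow> i \<in> G c \<Longrightarrow> T \<subseteq> A c i - W c \<Longrightarrow>
       \<rho> c T \<in> C \<and> W (\<rho> c T) = W c \<union> T \<and> A (\<rho> c T) = A c \<and> G (\<rho> c T) = G c"
    and fibre: "\<And>c' T. c' \<in> C \<Longrightarrow> T \<subseteq> U \<Longrightarrow> finite T \<Longrightarrow> card {c \<in> C. \<rho> c T = c'} \<le> M ^ card T"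
  shows "real (card {(c, i). c \<in> C \<and> i \<in> G c \<and> card (frag (G c) (A c) (W c) i) = t}) * R ^ t
    \<le> real (card C) * real (s choose t) * real M ^ t * K"
proof -
  let ?T = "\<lambda>c i. frag (G c) (A c) (W c) i"
  define B where "B = {(c, i). c \<in> C \<and> i \<in> G c \<and> card (?T c i) = t}"
  \<comment> \<open>The member \<open>J c'\<close> depends on the recoloured \<open>c'\<close>
    alone. A fragment leading to \<open>c'\<close> will turn out to be a subset of it, which leaves
    at most \<open>s choose t\<close> candidates.\<close>
  define J where "J c' = (SOME j. j \<in> G c' \<and> A c' j \<subseteq> W c')" for c'
  define D where "D = {c' \<in> C. \<exists>j. j \<in> G c' \<and> A c' j \<subseteq> W c'}"
  define E where "E c' = {T. T \<subseteq> A c' (J c') \<and> card T = t}" for c'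
  have J: "J c' \<in> G c' \<and> A c' (J c') \<subseteq> W c'" if "c' \<in> D" for c'
    using that unfolding D_def J_def by (metis (mono_tags, lifting) mem_Collect_eq someI_ex)
  have DC: "D \<subseteq> C" by (auto simp: D_def)
  have finD: "finite D" using fin DC finite_subset by blast
  have finE: "finite (E c')" and cardE: "card (E c') \<le> s choose t" and EU: "\<And>T. T \<in> E c' \<Longrightarrow> T \<subseteq> U \<and> finite T"
    if "c' \<in> D" for c'
  proof -
    have "A c' (J c') \<subseteq> U" "finite (A c' (J c'))" "card (A c' (J c')) \<le> s" using A J[OF that] DC that by auto
    then show "finite (E c')" "card (E c') \<le> s choose t" "\<And>T. T \<in> E c' \<Longrightarrow> T \<subseteq> U \<and> finite T"
      unfolding E_def by (auto simp: n_subsets binomial_right_mono intro: finite_subset)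
  qed
  \<comment> \<open>Bad pairs are encoded by the recolouring, the fragment and the pair itself. For
    fixed \<open>c'\<close> and \<open>T\<close> at most \<open>M ^ t\<close> old colourings remain,
    and spreadness leaves at most \<open>K / R ^ t\<close> members containing
    \<open>T\<close>.\<close>
  define Q where "Q = (SIGMA c':D. SIGMA T:E c'. {c \<in> C. \<rho> c T = c'} \<times> {i \<in> G c'. T \<subseteq> A c' i})"
  have sub: "(\<lambda>(c, i). (\<rho> c (?T c i), ?T c i, c, i)) ` B \<subseteq> Q"
  proof (clarsimp simp: image_iff Q_def)
    fix c i assume "(c, i) \<in> B"
    then have ci: "c \<in> C" "i \<in> G c" "card (?T c i) = t" by (auto simp: B_def)
    obtain j where j: "j \<in> G c" "A c j \<subseteq> W c \<union> A c i" "?T c i = A c j - W c"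
      and min: "\<And>j'. j' \<in> G c \<Longrightarrow> A c j' \<subseteq> W c \<union> A c i \<Longrightarrow> card (?T c i) \<le> card (A c j' - W c)"
      using frag_props[OF ci(2), of "A c" "W c"] by metis
    let ?c = "\<rho> c (?T c i)"
    have sub: "?T c i \<subseteq> A c i - W c" by (rule frag_subset[OF ci(2)])
    have r: "?c \<in> C" "W ?c = W c \<union> ?T c i" "A ?c = A c" "G ?c = G c"
      using recol[OF ci(1,2) sub] by auto
    have D: "?c \<in> D" unfolding D_def using r j by auto
    have J': "J ?c \<in> G c" "A c (J ?c) \<subseteq> W c \<union> ?T c i" using J[OF D] r by auto
    \<comment> \<open>The member \<open>J ?c\<close> lies in \<open>W c \<union> ?T c i\<close>,
      hence competes in the minimum defining the fragment. Its part outside \<open>W c\<close> lies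
      inside the fragment and is no smaller, so the two coincide.\<close>
    have "card (?T c i) \<le> card (A c (J ?c) - W c)" using J' sub by (intro min) auto
    moreover have "A c (J ?c) - W c \<subseteq> ?T c i" using J' by auto
    moreover have "finite (?T c i)" using A[OF ci(1) j(1)] j(3) by auto
    ultimately have "A c (J ?c) - W c = ?T c i" by (metis card_seteq)
    then have "?T c i \<subseteq> A c (J ?c)" by auto
    then show "?c \<in> D \<and> ?T c i \<in> E ?c \<and> c \<in> C \<and> i \<in> G ?c \<and> ?T c i \<subseteq> A ?c i"
      using D ci r sub by (auto simp: E_def)
  qed
  have finG: "finite {i \<in> G c'. T \<subseteq> A c' i}" if "c' \<in> D" for c' T
    using G[of c'] DC that finite_subset[OF _ fin(2), of "G c'"] by (auto intro: finite_subset)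
  have finQ: "finite Q"
    unfolding Q_def using finD finE fin(1) finG by (intro finite_SigmaI finite_cartesian_product) auto
  have "card B \<le> card Q"
    by (rule card_inj_on_le[OF _ sub finQ]) (auto simp: inj_on_def)
  then have "real (card B) * R ^ t \<le> real (card Q) * R ^ t" using R by (simp add: mult_right_mono)
  also have "real (card Q) = (\<Sum>c'\<in>D. \<Sum>T\<in>E c'. real (card {c \<in> C. \<rho> c T = c'}) * real (card {i \<in> G c'. T \<subseteq> A c' i}))"
    unfolding Q_def using finD finE fin(1) finG
    by (subst card_SigmaI; (simp add: card_cartesian_product)?)
  also have "\<dots> * R ^ t = (\<Sum>c'\<in>D. \<Sum>T\<in>E c'. real (card {c \<in> C. \<rho> c T = c'}) * (real (card {i \<in> G c'. T \<subseteq> A c' i}) * R ^ t))"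
    by (simp add: sum_distrib_right mult.assoc)
  also have "\<dots> \<le> (\<Sum>c'\<in>D. \<Sum>T\<in>E c'. real M ^ t * K)"
  proof (intro sum_mono mult_mono)
    fix c' T assume c': "c' \<in> D" and T: "T \<in> E c'"
    have ct: "card T = t" using T by (auto simp: E_def)
    show "real (card {c \<in> C. \<rho> c T = c'}) \<le> real M ^ t"
      using fibre[of c' T] c' DC EU[OF c' T] ct by (metis of_nat_le_iff of_nat_power subsetD)
    show "real (card {i \<in> G c'. T \<subseteq> A c' i}) * R ^ t \<le> K"
      using spread[of c' T] c' DC EU[OF c' T] ct by auto
  qed (use R in auto)
  also have "\<dots> = (\<Sum>c'\<in>D. real (card (E c')) * (real M ^ t * K))" by simp
  also have "\<dots> \<le> (\<Sum>c'\<in>D. real (s choose t) * (real M ^ t * K))"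
  proof (intro sum_mono mult_right_mono)
    fix c' assume c': "c' \<in> D"
    show "real (card (E c')) \<le> real (s choose t)" using cardE[OF c'] by simp
    show "0 \<le> real M ^ t * K" using K by simp
  qed
  also have "\<dots> = real (card D) * (real (s choose t) * (real M ^ t * K))" by simp
  also have "\<dots> \<le> real (card C) * (real (s choose t) * (real M ^ t * K))"
    using card_mono[OF fin(1) DC] K by (intro mult_right_mono) auto
  finally show ?thesis unfolding B_def by (simp add: mult.assoc)
qed

definition recolour :: "nat \<Rightarrow> ('a \<Rightarrow> nat) \<Rightarrow> 'a set \<Rightarrow> 'a \<Rightarrow> nat" where
  "recolour p c T = (\<lambda>u. if u \<in> T then p else c u)"

text \<open>Off \<open>T\<close> the old colouring can be read off from \<open>c'\<close>; only its
  values on \<open>T\<close> are lost.\<close>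

lemma recolour_fibre:
  assumes "finite T" "T \<subseteq> U"
  shows "card {c \<in> U \<rightarrow>\<^sub>E {..<m}. recolour p c T = c'} \<le> m ^ card T"
proof -
  let ?S = "{c \<in> U \<rightarrow>\<^sub>E {..<m}. recolour p c T = c'}"
  have "inj_on (\<lambda>c. restrict c T) ?S"
  proof (rule inj_onI)
    fix c d assume c: "c \<in> ?S" "d \<in> ?S" "restrict c T = restrict d T"
    show "c = d"
    proof
      fix u
      have "recolour p c T u = recolour p d T u" using c by simp
      moreover have "restrict c T u = restrict d T u" using c by simp
      ultimately show "c u = d u" by (cases "u \<in> T") (auto simp: recolour_def)
    qed
  qed
  moreover have "(\<lambda>c. restrict c T) ` ?S \<subseteq> T \<rightarrow>\<^sub>E {..<m}" using assms by (auto simp: PiE_def Pi_def)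
  moreover have "finite (T \<rightarrow>\<^sub>E {..<m})" using assms by (intro finite_PiE) auto
  ultimately have "card ?S \<le> card (T \<rightarrow>\<^sub>E {..<m})" by (rule card_inj_on_le)
  also have "\<dots> = m ^ card T" using assms by (simp add: card_PiE)
  finally show ?thesis .
qed

lemma recolour_in_PiE:
  "c \<in> U \<rightarrow>\<^sub>E {..<m} \<Longrightarrow> T \<subseteq> U \<Longrightarrow> p < m \<Longrightarrow> recolour p c T \<in> U \<rightarrow>\<^sub>E {..<m}"
  by (auto simp: recolour_def PiE_def Pi_def extensional_def)

text \<open>
  Each of the two colours is one round of fragmentation: the first brings all but few members down
  to size \<^term>\<open>s\<close>, the second makes most of these fragments empty.
\<close>

lemma few_bad_colourings:
  fixes R K :: real and A :: "'i \<Rightarrow> 'a set" and p q :: nat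
  assumes fin: "finite U" "finite I" "I \<noteq> {}" and R: "R > 0"
    and A: "\<And>i. i \<in> I \<Longrightarrow> A i \<subseteq> U \<and> card (A i) \<le> n"
    and spread: "\<And>Z. Z \<subseteq> U \<Longrightarrow> real (card {i \<in> I. Z \<subseteq> A i}) * R ^ card Z \<le> K"
    and K: "K \<le> 2 * card I" "K \<ge> 0"
    and \<beta>: "(\<Sum>t\<in>{s<..n}. real (n choose t) * (4 / R) ^ t) + (\<Sum>t\<in>{0<..s}. real (s choose t) * (4 / R) ^ t) < 1 / 4"
    and pq: "p < 4" "q < 4" "p \<noteq> q"
  shows "2 * card {c \<in> U \<rightarrow>\<^sub>E {..<4}. \<not> (\<exists>i\<in>I. c ` A i \<subseteq> {p, q})} < card (U \<rightarrow>\<^sub>E {..<4::nat})"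
proof -
  define C where "C = U \<rightarrow>\<^sub>E {..<4::nat}"
  define F where "F = {c \<in> C. \<not> (\<exists>i\<in>I. c ` A i \<subseteq> {p, q})}"
  define W where "W a c = {u \<in> U. c u = a}" for a :: nat and c :: "'a \<Rightarrow> nat"
  \<comment> \<open>\<open>A2\<close> is the outcome of the first round, with colour
    \<open>p\<close>, and \<open>G2\<close> keeps the indices whose fragment is small.
    \<open>B1\<close> and \<open>B2\<close> count by size the fragments of the two rounds.\<close>
  define A2 where "A2 c i = frag I A (W p c) i" for c i
  define G2 where "G2 c = {i \<in> I. card (A2 c i) \<le> s}" for c
  define f2 where "f2 c i = frag (G2 c) (A2 c) (W q c) i" for c i
  define B1 where "B1 t = {(c, i). c \<in> C \<and> i \<in> I \<and> card (A2 c i) = t}" for t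
  define B2 where "B2 t = {(c, i). c \<in> C \<and> i \<in> G2 c \<and> card (f2 c i) = t}" for t
  have finC: "finite C" unfolding C_def using fin by (intro finite_PiE) auto
  have C0: "card C > 0" unfolding C_def using fin by (simp add: card_PiE)
  have A2: "A2 c i \<subseteq> A i - W p c" if "i \<in> I" for c i
    unfolding A2_def by (rule frag_subset[OF that])
  have finA: "finite (A i)" if "i \<in> I" for i using A[OF that] fin finite_subset by blast
  have Wrec: "W a (recolour a c T) = W a c \<union> T" if "T \<subseteq> U" for a c T
    using that by (auto simp: W_def recolour_def)
  have Wrec': "W p (recolour q c T) = W p c" if "T \<inter> W p c = {}" for c T
    using that pq by (auto simp: W_def recolour_def)
  have B1: "real (card (B1 t)) * R ^ t \<le> real (card C) * real (n choose t) * real 4 ^ t * K" for t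
    unfolding B1_def A2_def
  proof (rule card_large_fragments[of C I R K "\<lambda>_. I" "\<lambda>_. A" U n "W p" "recolour p" 4 t])
    fix c i T assume "c \<in> C" "i \<in> I" "T \<subseteq> A i - W p c"
    then have "T \<subseteq> U" using A by auto
    then show "recolour p c T \<in> C \<and> W p (recolour p c T) = W p c \<union> T \<and> A = A \<and> I = I"
      using \<open>c \<in> C\<close> pq by (auto simp: C_def Wrec recolour_in_PiE)
  next
    fix c' T show "T \<subseteq> U \<Longrightarrow> finite T \<Longrightarrow> card {c \<in> C. recolour p c T = c'} \<le> 4 ^ card T"
      unfolding C_def by (rule recolour_fibre)
  qed (use finC fin R K A finA spread in auto)
  have B2: "real (card (B2 t)) * R ^ t \<le> real (card C) * real (s choose t) * real 4 ^ t * K" for t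
    unfolding B2_def f2_def
  proof (rule card_large_fragments[of C I R K G2 A2 U s "W q" "recolour q" 4 t])
    fix c i T assume c: "c \<in> C" "i \<in> G2 c" "T \<subseteq> A2 c i - W q c"
    have "i \<in> I" using c by (auto simp: G2_def)
    then have T: "T \<subseteq> U" "T \<inter> W p c = {}" using A[of i] A2[of i c] c by auto
    \<comment> \<open>First-round fragments avoid colour \<open>p\<close>, so painting part of one
      with \<open>q\<close> leaves the class of \<open>p\<close>, and with it the whole first round,
      unchanged.\<close>
    have "A2 (recolour q c T) = A2 c" by (intro ext) (simp add: A2_def Wrec'[OF T(2)])
    moreover from this have "G2 (recolour q c T) = G2 c" by (simp add: G2_def)
    ultimately show "recolour q c T \<in> C \<and> W q (recolour q c T) = W q c \<union> T \<and> A2 (recolour q c T) = A2 c \<and> G2 (recolour q c T) = G2 c"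
      using T c pq by (auto simp: C_def Wrec recolour_in_PiE)
  next
    fix c' T show "T \<subseteq> U \<Longrightarrow> finite T \<Longrightarrow> card {c \<in> C. recolour q c T = c'} \<le> 4 ^ card T"
      unfolding C_def by (rule recolour_fibre)
  next
    fix c Z assume "c \<in> C" "Z \<subseteq> U"
    have "card {i \<in> G2 c. Z \<subseteq> A2 c i} \<le> card {i \<in> I. Z \<subseteq> A i}"
      using fin A2[of _ c] by (intro card_mono) (auto simp: G2_def)
    then show "real (card {i \<in> G2 c. Z \<subseteq> A2 c i}) * R ^ card Z \<le> K"
      using spread[OF \<open>Z \<subseteq> U\<close>] R
      by (meson mult_right_mono of_nat_le_iff order_trans zero_le_power less_imp_le)
  next
    fix c i assume "c \<in> C" "i \<in> G2 c"
    then show "A2 c i \<subseteq> U \<and> finite (A2 c i) \<and> card (A2 c i) \<le> s"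
      using A A2[of i c] finA[of i] finite_subset[of "A2 c i" "A i"] by (auto simp: G2_def)
  qed (use finC fin R K in \<open>auto simp: G2_def\<close>)
  \<comment> \<open>If the first fragment of \<open>i\<close> is small and its second fragment is
    empty, some small fragment \<open>A2 c j = A l - W p c\<close> has colour \<open>q\<close>
    throughout. Then member \<open>l\<close> uses only \<open>p\<close> and \<open>q\<close>, so
    \<open>c\<close> is not bad.\<close>
  have cover: "F \<times> I \<subseteq> (\<Union>t\<in>{s<..n}. B1 t) \<union> (\<Union>t\<in>{0<..s}. B2 t)"
  proof (clarify)
    fix c i assume c: "c \<in> F" and i: "i \<in> I" and n2: "(c, i) \<notin> (\<Union>t\<in>{0<..s}. B2 t)"
    have cC: "c \<in> C" using c by (simp add: F_def)
    have "card (A2 c i) \<le> n"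
      using card_mono[OF finA[OF i], of "A2 c i"] A2[OF i, of c] A[OF i] by (metis Diff_subset order_trans)
    moreover have "card (A2 c i) > s"
    proof (rule ccontr)
      assume "\<not> card (A2 c i) > s"
      then have iG: "i \<in> G2 c" using i by (simp add: G2_def)
      obtain j where j: "j \<in> G2 c" "A2 c j \<subseteq> W q c \<union> A2 c i" "f2 c i = A2 c j - W q c"
        using frag_props[OF iG, of "A2 c" "W q c"] unfolding f2_def by metis
      have jI: "j \<in> I" using j by (simp add: G2_def)
      have fin2: "finite (A2 c j)" using finite_subset[of "A2 c j" "A j"] A2[OF jI, of c] finA[OF jI] by auto
      have "card (f2 c i) \<le> card (A2 c j)" unfolding j(3) by (rule card_mono[OF fin2]) auto
      then have "card (f2 c i) \<le> s" using j(1) by (simp add: G2_def)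
      then have "card (f2 c i) = 0" using n2 cC iG by (auto simp: B2_def)
      then have sub: "A2 c j \<subseteq> W q c" using j(3) fin2 by auto
      obtain l where l: "l \<in> I" "A2 c j = A l - W p c"
        using frag_props[OF jI, of A "W p c"] unfolding A2_def by metis
      have "c ` A l \<subseteq> {p, q}" using sub l(2) by (auto simp: W_def)
      then show False using c l(1) by (auto simp: F_def)
    qed
    ultimately show "(c, i) \<in> (\<Union>t\<in>{s<..n}. B1 t)" using cC i by (auto simp: B1_def)
  qed
  have finB: "finite (B1 t)" "finite (B2 t)" for t
    by (rule finite_subset[of _ "C \<times> I"]; use finC fin in \<open>auto simp: B1_def B2_def G2_def\<close>)+
  have "card F * card I \<le> card ((\<Union>t\<in>{s<..n}. B1 t) \<union> (\<Union>t\<in>{0<..s}. B2 t))"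
    using card_mono[OF _ cover] finB by (simp add: card_cartesian_product)
  also have "\<dots> \<le> card (\<Union>t\<in>{s<..n}. B1 t) + card (\<Union>t\<in>{0<..s}. B2 t)" by (rule card_Un_le)
  also have "\<dots> \<le> (\<Sum>t\<in>{s<..n}. card (B1 t)) + (\<Sum>t\<in>{0<..s}. card (B2 t))"
    by (intro add_mono card_UN_le) auto
  finally have "real (card F) * real (card I) \<le> (\<Sum>t\<in>{s<..n}. real (card (B1 t))) + (\<Sum>t\<in>{0<..s}. real (card (B2 t)))"
    by (simp flip: of_nat_mult of_nat_sum of_nat_add)
  also have "\<dots> \<le> (\<Sum>t\<in>{s<..n}. card C * K * (real (n choose t) * (4 / R) ^ t)) + (\<Sum>t\<in>{0<..s}. card C * K * (real (s choose t) * (4 / R) ^ t))"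
    using B1 B2 R by (intro add_mono sum_mono) (simp_all add: field_simps power_divide)
  also have "\<dots> = card C * (K * ((\<Sum>t\<in>{s<..n}. real (n choose t) * (4 / R) ^ t) + (\<Sum>t\<in>{0<..s}. real (s choose t) * (4 / R) ^ t)))"
    by (simp add: sum_distrib_left algebra_simps)
  \<comment> \<open>The factor 2 from \<open>K \<le> 2 * card I\<close> meets the bound
    \<open>1 / 4\<close> in \<open>\<beta>\<close>; this makes fewer than half of the colourings
    bad.\<close>
  also have "\<dots> \<le> card C * ((2 * card I) * ((\<Sum>t\<in>{s<..n}. real (n choose t) * (4 / R) ^ t) + (\<Sum>t\<in>{0<..s}. real (s choose t) * (4 / R) ^ t)))"
    using K R by (intro mult_left_mono mult_right_mono add_nonneg_nonneg sum_nonneg) auto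
  also have "\<dots> < card C * ((2 * card I) * (1 / 4))"
    using C0 fin \<beta> by (intro mult_strict_left_mono) (auto simp: card_gt_0_iff)
  finally have "real (card I) * (2 * real (card F)) < real (card I) * real (card C)" by (simp add: mult_ac)
  then have "2 * card F < card C" using fin by (simp add: mult_less_cancel_left card_gt_0_iff)
  then show ?thesis unfolding F_def C_def .
qed

text \<open>Colours 0, 1 serve the first family and 2, 3 the second. Each has fewer than half of the
  colourings against it, so one colouring suits both, and members using disjoint sets of colours are
  disjoint.\<close>

lemma spread_families_disjoint:
  fixes R K L :: real and A :: "'i \<Rightarrow> 'a set" and B :: "'j \<Rightarrow> 'a set"
  assumes U: "finite U" and R: "R > 0"
    and \<beta>: "(\<Sum>t\<in>{s<..n}. real (n choose t) * (4 / R) ^ t) + (\<Sum>t\<in>{0<..s}. real (s choose t) * (4 / R) ^ t) < 1 / 4"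
    and I: "finite I" "I \<noteq> {}" "\<And>i. i \<in> I \<Longrightarrow> A i \<subseteq> U \<and> card (A i) \<le> n"
      "\<And>Z. Z \<subseteq> U \<Longrightarrow> real (card {i \<in> I. Z \<subseteq> A i}) * R ^ card Z \<le> K" "K \<le> 2 * card I" "K \<ge> 0"
    and J: "finite J" "J \<noteq> {}" "\<And>i. i \<in> J \<Longrightarrow> B i \<subseteq> U \<and> card (B i) \<le> n"
      "\<And>Z. Z \<subseteq> U \<Longrightarrow> real (card {i \<in> J. Z \<subseteq> B i}) * R ^ card Z \<le> L" "L \<le> 2 * card J" "L \<ge> 0"
  shows "\<exists>i\<in>I. \<exists>j\<in>J. A i \<inter> B j = {}"
proof -
  let ?C = "U \<rightarrow>\<^sub>E {..<4::nat}"
  let ?F = "{c \<in> ?C. \<not> (\<exists>i\<in>I. c ` A i \<subseteq> {0, 1::nat})}" and ?F' = "{c \<in> ?C. \<not> (\<exists>i\<in>J. c ` B i \<subseteq> {2, 3::nat})}"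
  have "2 * card ?F < card ?C" by (rule few_bad_colourings[OF U I(1,2) R I(3-6) \<beta>]) auto
  moreover have "2 * card ?F' < card ?C" by (rule few_bad_colourings[OF U J(1,2) R J(3-6) \<beta>]) auto
  moreover have "finite ?C" using U by (intro finite_PiE) auto
  ultimately have "\<not> ?C \<subseteq> ?F \<union> ?F'"
    using card_mono[of "?F \<union> ?F'" ?C] card_Un_le[of ?F ?F'] by auto
  then obtain c i j where c: "i \<in> I" "j \<in> J" "c ` A i \<subseteq> {0, 1::nat}" "c ` B j \<subseteq> {2, 3}" by auto
  have "A i \<inter> B j = {}"
  proof (rule equals0I)
    fix u assume "u \<in> A i \<inter> B j"
    then have "c u \<in> {0, 1}" "c u \<in> {2, 3}" using c by blast+
    then show False by auto
  qed
  then show ?thesis using c by blast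
qed

section \<open>Numerical bounds for the two rounds of fragmentation\<close>

lemma power_self_le_fact: "real t ^ t \<le> 3 ^ t * fact t"
proof -
  \<comment> \<open>One term of the exponential series at \<open>t\<close> is at most its sum, the
    \<open>t\<close>-th power of \<open>exp 1 \<le> 3\<close>.\<close>
  have "real t ^ t /\<^sub>R fact t \<le> (\<Sum>n. real t ^ n /\<^sub>R fact n)"
    using sum_le_suminf[OF summable_exp_generic[of "real t"], of "{t}"] by simp
  also have "\<dots> = exp 1 ^ t"
    using exp_of_nat_mult[of t "1::real"] by (simp add: exp_def)
  also have "\<dots> \<le> 3 ^ t" by (intro power_mono exp_le) auto
  finally show ?thesis by (simp add: field_simps)
qed

lemma sum_power_le:
  fixes x :: real
  assumes "0 \<le> x" "x \<le> 1 / 2" shows "(\<Sum>t\<in>{0<..m}. x ^ t) \<le> 2 * x"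
proof -
  \<comment> \<open>The subtracted term strengthens the claim so that the induction closes.\<close>
  have "(\<Sum>t\<in>{0<..m}. x ^ t) \<le> 2 * x - x ^ m * (2 * x)"
  proof (induction m)
    case (Suc m)
    have "{0<..Suc m} = insert (Suc m) {0<..m}" by auto
    then have "(\<Sum>t\<in>{0<..Suc m}. x ^ t) \<le> x ^ Suc m + (2 * x - x ^ m * (2 * x))" using Suc by (simp add: algebra_simps)
    also have "\<dots> \<le> 2 * x - x ^ Suc m * (2 * x)"
      using assms mult_left_mono[of x "1/2" "x ^ Suc m"] by (simp add: algebra_simps)
    finally show ?case .
  qed (use assms in auto)
  then show ?thesis using assms by (smt (verit) mult_nonneg_nonneg zero_le_power)
qed

text \<open>The cutoff \<open>y ^ 4\<close> balances the rounds. Above it \<open>n choose t\<close>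
  is at most \<open>(3 * n / t) ^ t \<le> (3 * y ^ 4) ^ t\<close>, which makes the terms at most
  \<open>(12 / y) ^ t\<close>; in the second round they are at most \<open>(4 / y) ^ t\<close>. The
  total is at most \<open>32 / y\<close>.\<close>

lemma fragment_tail:
  fixes y :: real
  assumes y: "y \<ge> 200" "real n = y ^ 8"
  shows "(\<Sum>t\<in>{nat \<lfloor>y ^ 4\<rfloor><..n}. real (n choose t) * (4 / y ^ 5) ^ t)
    + (\<Sum>t\<in>{0<..nat \<lfloor>y ^ 4\<rfloor>}. real (nat \<lfloor>y ^ 4\<rfloor> choose t) * (4 / y ^ 5) ^ t) < 1 / 4"
proof -
  define s where "s = nat \<lfloor>y ^ 4\<rfloor>"
  have y0: "y > 0" using y by simp
  have s: "real s \<le> y ^ 4" using y0 by (simp add: s_def)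
  have 1: "real (n choose t) * (4 / y ^ 5) ^ t \<le> (12 / y) ^ t" if "t \<in> {s<..n}" for t
  proof -
    have t: "real t \<ge> y ^ 4" using that unfolding s_def by (simp add: floor_less_iff) linarith
    then have t0: "real t > 0" using y0 by (smt (verit) zero_less_power)
    have "real (n choose t) * fact t \<le> real n ^ t"
      using binomial_fact_pow[of n t] by (metis of_nat_fact of_nat_le_iff of_nat_mult of_nat_power)
    then have "3 ^ t * (real (n choose t) * fact t) \<le> 3 ^ t * real n ^ t" by simp
    moreover have "real (n choose t) * real t ^ t \<le> real (n choose t) * (3 ^ t * fact t)"
      by (intro mult_left_mono power_self_le_fact) auto
    ultimately have "real (n choose t) * real t ^ t \<le> 3 ^ t * real n ^ t" by (simp only: mult_ac)
    then have "real (n choose t) * (y ^ 4) ^ t \<le> (3 * y ^ 8) ^ t"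
      using t y0 y(2) mult_left_mono[OF power_mono[OF t, of t], of "real (n choose t)"]
      by (simp add: power_mult_distrib)
    then have "real (n choose t) \<le> (3 * y ^ 8) ^ t / (y ^ 4) ^ t"
      using y0 by (simp add: pos_le_divide_eq)
    also have "\<dots> = (3 * y ^ 4) ^ t"
    proof -
      have "(y ^ 8) ^ t = (y ^ 4) ^ t * (y ^ 4) ^ t"
        by (simp flip: power_mult power_add)
      then show ?thesis using y0 by (simp add: power_mult_distrib)
    qed
    finally have "real (n choose t) * (4 / y ^ 5) ^ t \<le> (3 * y ^ 4) ^ t * (4 / y ^ 5) ^ t"
      using y0 by (intro mult_right_mono) auto
    also have "\<dots> = (12 / y) ^ t"
      using y0 unfolding power_mult_distrib[symmetric] by (simp add: eval_nat_numeral)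
    finally show ?thesis .
  qed
  have 2: "real (s choose t) * (4 / y ^ 5) ^ t \<le> (4 / y) ^ t" for t
  proof -
    have "real (s choose t) \<le> (y ^ 4) ^ t"
      using binomial_le_pow2 binomial_fact_pow[of s t] power_mono[OF s, of t] fact_ge_1[of t]
      by (smt (verit) binomial_fact_pow mult_le_cancel_left1 of_nat_0_le_iff of_nat_fact of_nat_le_iff of_nat_mult of_nat_power fact_ge_1)
    then have "real (s choose t) * (4 / y ^ 5) ^ t \<le> (y ^ 4) ^ t * (4 / y ^ 5) ^ t"
      using y0 by (intro mult_right_mono) auto
    also have "\<dots> = (4 / y) ^ t"
      using y0 unfolding power_mult_distrib[symmetric] by (simp add: eval_nat_numeral)
    finally show ?thesis .
  qed
  have "(\<Sum>t\<in>{s<..n}. real (n choose t) * (4 / y ^ 5) ^ t) \<le> (\<Sum>t\<in>{s<..n}. (12 / y) ^ t)"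
    using 1 by (intro sum_mono) auto
  also have "\<dots> \<le> (\<Sum>t\<in>{0<..n}. (12 / y) ^ t)" using y0 by (intro sum_mono2) auto
  also have "\<dots> \<le> 2 * (12 / y)" using y y0 by (intro sum_power_le) (auto simp: field_simps)
  finally have a: "(\<Sum>t\<in>{s<..n}. real (n choose t) * (4 / y ^ 5) ^ t) \<le> 24 / y" by simp
  have "(\<Sum>t\<in>{0<..s}. real (s choose t) * (4 / y ^ 5) ^ t) \<le> (\<Sum>t\<in>{0<..s}. (4 / y) ^ t)"
    using 2 by (intro sum_mono) auto
  also have "\<dots> \<le> 2 * (4 / y)" using y y0 by (intro sum_power_le) (auto simp: field_simps)
  finally have b: "(\<Sum>t\<in>{0<..s}. real (s choose t) * (4 / y ^ 5) ^ t) \<le> 8 / y" by simp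
  have "24 / y + 8 / y < 1 / 4" using y y0 by (simp add: field_simps)
  then show ?thesis using a b unfolding s_def by linarith
qed

section \<open>Spread approximation\<close>

text \<open>This is \<open>R\<close>-spreadness of the link of \<open>X\<close>. Sets
  \<open>Z\<close> meeting \<open>X\<close> are left out because points of \<open>X\<close> lie in
  every member and cannot be rare.\<close>

definition spread_over :: "real \<Rightarrow> ('i \<Rightarrow> 'a set) \<Rightarrow> 'a set \<Rightarrow> 'i set \<Rightarrow> bool" where
  "spread_over R g X H \<longleftrightarrow> finite H \<and> H \<noteq> {} \<and> (\<forall>i\<in>H. X \<subseteq> g i) \<and>
     (\<forall>Z. finite Z \<longrightarrow> Z \<inter> X = {} \<longrightarrow> real (card {i \<in> H. Z \<subseteq> g i}) * R ^ card Z \<le> card H)"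

definition spread_cores :: "real \<Rightarrow> nat \<Rightarrow> ('i \<Rightarrow> 'a set) \<Rightarrow> 'i set \<Rightarrow> 'a set set" where
  "spread_cores R q g F = {X. finite X \<and> card X \<le> q \<and> (\<exists>H\<subseteq>F. spread_over R g X H)}"

text \<open>A largest set \<open>X\<close> of relative density at least \<open>R\<close> to the power \<open>-|X|\<close> is the core of a spread subfamily.\<close>

lemma spread_approximation:
  fixes q :: nat
  assumes U: "finite U" "\<And>i. i \<in> F \<Longrightarrow> g i \<subseteq> U" and F: "finite F" and R: "R > 0"
  defines "F' \<equiv> {i \<in> F. \<forall>X\<in>spread_cores R q g F. \<not> X \<subseteq> g i}"
  shows "F' = {} \<or> (\<exists>X\<subseteq>U. q < card X \<and> real (card F') \<le> R ^ card X * card {i \<in> F'. X \<subseteq> g i})"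
proof (cases "F' = {}")
  case False
  let ?d = "\<lambda>X. {i \<in> F'. X \<subseteq> g i}"
  define \<X> where "\<X> = {X. X \<subseteq> U \<and> real (card F') \<le> R ^ card X * card (?d X)}"
  have F'F: "F' \<subseteq> F" by (auto simp: F'_def)
  then have finF': "finite F'" using F finite_subset by auto
  have "finite \<X>" unfolding \<X>_def using U by simp
  moreover have "{} \<in> \<X>" by (simp add: \<X>_def)
  ultimately have "Max (card ` \<X>) \<in> card ` \<X>" by (intro Max_in) auto
  then obtain X where X: "X \<in> \<X>" "card X = Max (card ` \<X>)" by auto
  have max: "card Y \<le> card X" if "Y \<in> \<X>" for Y
    using that \<open>finite \<X>\<close> X(2) by simp
  have XU: "X \<subseteq> U" and finX: "finite X" using X U finite_subset by (auto simp: \<X>_def)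
  have Xd: "real (card F') \<le> R ^ card X * card (?d X)" using X by (simp add: \<X>_def)
  have "card F' > 0" using False finF' by (simp add: card_gt_0_iff)
  then have ne: "?d X \<noteq> {}" using Xd by (metis card.empty mult_zero_right not_le of_nat_0 of_nat_0_less_iff)
  have "spread_over R g X (?d X)"
    unfolding spread_over_def
  proof (intro conjI allI impI ballI)
    fix Z assume Z: "finite Z" "Z \<inter> X = {}"
    have eq: "{i \<in> ?d X. Z \<subseteq> g i} = ?d (X \<union> Z)" by auto
    show "real (card {i \<in> ?d X. Z \<subseteq> g i}) * R ^ card Z \<le> card (?d X)"
    proof (cases "?d (X \<union> Z) = {}")
      case True
      show ?thesis unfolding eq True by simp
    next
      case ne: False
      show ?thesis
      proof (cases "Z = {}")
        case False
        then have "X \<union> Z \<subseteq> U" using U(2) F'F ne by blast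
        moreover have "card (X \<union> Z) = card X + card Z" using Z finX by (simp add: card_Un_disjoint Int_commute)
        moreover have "card Z > 0" using Z False by (simp add: card_gt_0_iff)
        ultimately have "X \<union> Z \<notin> \<X>" using max[of "X \<union> Z"] by auto
        \<comment> \<open>Maximality of \<open>X\<close> excludes the larger set
          \<open>X \<union> Z\<close>; comparison with the density of \<open>X\<close> gives the
          spread inequality.\<close>
        then have "R ^ card X * (R ^ card Z * card (?d (X \<union> Z))) < real (card F')"
          using \<open>X \<union> Z \<subseteq> U\<close> \<open>card (X \<union> Z) = _\<close> by (simp add: \<X>_def power_add mult.assoc)
        also note Xd
        finally have "R ^ card Z * card (?d (X \<union> Z)) < card (?d X)"
          using R by (simp add: mult_less_cancel_left)
        then show ?thesis unfolding eq by (simp add: mult.commute)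
      qed simp
    qed
  qed (use ne finF' in auto)
  then have core: "X \<in> spread_cores R q g F" if "card X \<le> q"
    unfolding spread_cores_def using that finX F'F by (intro CollectI conjI exI[of _ "?d X"]) auto
  \<comment> \<open>No member of \<open>F'\<close> contains a core of size at most \<open>q\<close>,
    so the spread core \<open>X\<close> has to be larger.\<close>
  obtain i where "i \<in> F'" "X \<subseteq> g i" using ne by auto
  then have "X \<notin> spread_cores R q g F" by (auto simp: F'_def)
  then have "q < card X" using core by (meson not_le)
  then show ?thesis using XU Xd by (intro disjI2 exI[of _ X]) simp
qed auto

text \<open>For disjoint cores, members of each spread subfamily that meet the other core are
  discarded, which keeps at least half of it. The remainders, without their cores, are spread enough
  to have disjoint members; restoring the cores creates no intersection.\<close>

lemma spread_cores_intersect: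
  assumes g: "\<And>i. i \<in> F \<Longrightarrow> g i \<subseteq> U \<and> card (g i) \<le> n" and U: "finite U"
    and F: "finite F" "\<And>i j. i \<in> F \<Longrightarrow> j \<in> F \<Longrightarrow> g i \<inter> g j \<noteq> {}"
    and R: "R > 0" "2 * real q \<le> R"
    and \<beta>: "(\<Sum>t\<in>{s<..n}. real (n choose t) * (4 / R) ^ t) + (\<Sum>t\<in>{0<..s}. real (s choose t) * (4 / R) ^ t) < 1 / 4"
    and XY: "X \<in> spread_cores R q g F" "Y \<in> spread_cores R q g F"
  shows "X \<inter> Y \<noteq> {}"
proof
  assume disj: "X \<inter> Y = {}"
  have prep: thesis
    if H: "H \<subseteq> F" "spread_over R g X H" and Y: "finite Y" "card Y \<le> q" "X \<inter> Y = {}"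
      and res: "\<And>I. I \<subseteq> F \<Longrightarrow> finite I \<Longrightarrow> I \<noteq> {} \<Longrightarrow> real (card H) \<le> 2 * card I \<Longrightarrow>
        (\<And>i. i \<in> I \<Longrightarrow> g i \<inter> Y = {} \<and> g i - X \<subseteq> U \<and> card (g i - X) \<le> n) \<Longrightarrow>
        (\<And>Z. Z \<subseteq> U \<Longrightarrow> real (card {i \<in> I. Z \<subseteq> g i - X}) * R ^ card Z \<le> card H) \<Longrightarrow> thesis"
    for X Y H thesis
  proof -
    define I where I: "I = {i \<in> H. g i \<inter> Y = {}}"
    have finH: "finite H" "H \<noteq> {}"
      and sp: "\<And>Z. finite Z \<Longrightarrow> Z \<inter> X = {} \<Longrightarrow> real (card {i \<in> H. Z \<subseteq> g i}) * R ^ card Z \<le> card H"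
      using H by (auto simp: spread_over_def)
    \<comment> \<open>Union bound over the points of \<open>Y\<close>: by spreadness each lies in at
      most a fraction \<open>1 / R\<close> of \<open>H\<close>, and
      \<open>q / R \<le> 1 / 2\<close>.\<close>
    have "H - I \<subseteq> (\<Union>u\<in>Y. {i \<in> H. {u} \<subseteq> g i})" using I by auto
    then have "card (H - I) \<le> card (\<Union>u\<in>Y. {i \<in> H. {u} \<subseteq> g i})"
      using Y finH by (intro card_mono) auto
    also have "\<dots> \<le> (\<Sum>u\<in>Y. card {i \<in> H. {u} \<subseteq> g i})" by (rule card_UN_le[OF Y(1)])
    finally have "real (card (H - I)) * R \<le> (\<Sum>u\<in>Y. real (card {i \<in> H. {u} \<subseteq> g i})) * R"
      using R by (simp flip: of_nat_sum)
    also have "\<dots> = (\<Sum>u\<in>Y. real (card {i \<in> H. {u} \<subseteq> g i}) * R ^ card {u})"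
      by (simp add: sum_distrib_right)
    also have "\<dots> \<le> (\<Sum>u\<in>Y. real (card H))" using Y by (intro sum_mono sp) auto
    also have "\<dots> = card Y * real (card H)" by simp
    also have "\<dots> \<le> (R / 2) * real (card H)" using Y R by (intro mult_right_mono) auto
    finally have "2 * real (card (H - I)) \<le> card H"
      using R by (simp add: field_simps)
    moreover have "card (H - I) = card H - card I" "card I \<le> card H"
      using finH I by (auto intro!: card_Diff_subset card_mono)
    ultimately have IH: "real (card H) \<le> 2 * card I" by linarith
    have "I \<noteq> {}" using IH finH by (auto simp: card_gt_0_iff)
    moreover have "real (card {i \<in> I. Z \<subseteq> g i - X}) * R ^ card Z \<le> card H" if "Z \<subseteq> U" for Z
    proof (cases "Z \<inter> X = {}")
      case True
      have "card {i \<in> I. Z \<subseteq> g i - X} \<le> card {i \<in> H. Z \<subseteq> g i}"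
        using finH I by (intro card_mono) auto
      then have "real (card {i \<in> I. Z \<subseteq> g i - X}) * R ^ card Z \<le> real (card {i \<in> H. Z \<subseteq> g i}) * R ^ card Z"
        using R by (intro mult_right_mono) auto
      also have "\<dots> \<le> card H" using finite_subset[OF that U] True by (rule sp)
      finally show ?thesis .
    next
      case False
      then have e: "{i \<in> I. Z \<subseteq> g i - X} = {}" by auto
      show ?thesis unfolding e by simp
    qed
    moreover have "g i \<inter> Y = {} \<and> g i - X \<subseteq> U \<and> card (g i - X) \<le> n" if "i \<in> I" for i
    proof -
      have i: "i \<in> F" using that H I by auto
      then have "card (g i - X) \<le> card (g i)"
        using g finite_subset[OF _ U, of "g i"] by (intro card_mono) auto
      moreover have "g i \<inter> Y = {}" using that I by simp
      ultimately show ?thesis using g[OF i] by auto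
    qed
    moreover have "finite I" "I \<subseteq> F" using finH H I by auto
    ultimately show thesis using IH by (intro res[of I]) simp_all
  qed
  obtain H where H: "H \<subseteq> F" "spread_over R g X H" using XY by (auto simp: spread_cores_def)
  obtain H' where H': "H' \<subseteq> F" "spread_over R g Y H'" using XY by (auto simp: spread_cores_def)
  have fin: "finite X" "card X \<le> q" "finite Y" "card Y \<le> q" using XY by (auto simp: spread_cores_def)
  obtain I where I: "I \<subseteq> F" "finite I" "I \<noteq> {}" "real (card H) \<le> 2 * card I"
      and I1: "\<And>i. i \<in> I \<Longrightarrow> g i \<inter> Y = {} \<and> g i - X \<subseteq> U \<and> card (g i - X) \<le> n"
      and I2: "\<And>Z. Z \<subseteq> U \<Longrightarrow> real (card {i \<in> I. Z \<subseteq> g i - X}) * R ^ card Z \<le> card H"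
    by (rule prep[OF H fin(3,4) disj]) (rule that)
  obtain J where J: "J \<subseteq> F" "finite J" "J \<noteq> {}" "real (card H') \<le> 2 * card J"
      and J1: "\<And>i. i \<in> J \<Longrightarrow> g i \<inter> X = {} \<and> g i - Y \<subseteq> U \<and> card (g i - Y) \<le> n"
      and J2: "\<And>Z. Z \<subseteq> U \<Longrightarrow> real (card {i \<in> J. Z \<subseteq> g i - Y}) * R ^ card Z \<le> card H'"
    by (rule prep[OF H' fin(1,2) disj[unfolded Int_commute[of X]]]) (rule that)
  have "\<exists>i\<in>I. \<exists>j\<in>J. (g i - X) \<inter> (g j - Y) = {}"
    by (rule spread_families_disjoint[OF U R(1) \<beta> I(2,3) _ I2 I(4) _ J(2,3) _ J2 J(4)])
      (simp_all add: I1 J1)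
  then obtain i j where ij: "i \<in> I" "j \<in> J" "(g i - X) \<inter> (g j - Y) = {}" by blast
  then have "g i \<inter> g j = {}" using I1[OF ij(1)] J1[OF ij(2)] by blast
  then show False using F(2) I(1) J(1) ij by blast
qed

text \<open>Fix a member \<open>X0\<close> and, for each \<open>x\<close> in it, a member
  \<open>h x\<close> avoiding \<open>x\<close>. Every member meets \<open>X0\<close> in some
  \<open>x\<close> and then \<open>h x\<close> in some \<open>y\<close>, which differs from
  \<open>x\<close>.\<close>

lemma intersecting_pairs:
  assumes S: "\<And>X Y. X \<in> S \<Longrightarrow> Y \<in> S \<Longrightarrow> X \<inter> Y \<noteq> {}"
    and fin: "\<And>X. X \<in> S \<Longrightarrow> finite X \<and> card X \<le> q"
    and nc: "\<And>x. \<exists>X\<in>S. x \<notin> X"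
  obtains P where "finite P" "card P \<le> q * q" "\<And>x y. (x, y) \<in> P \<Longrightarrow> x \<noteq> y"
    "\<And>X. X \<in> S \<Longrightarrow> \<exists>(x, y)\<in>P. x \<in> X \<and> y \<in> X"
proof -
  obtain h where h: "\<And>x. h x \<in> S" "\<And>x. x \<notin> h x" using nc by metis
  obtain X0 where X0: "X0 \<in> S" using nc by blast
  let ?P = "SIGMA x:X0. h x"
  have f: "finite X0" "card X0 \<le> q" "\<And>x. finite (h x) \<and> card (h x) \<le> q" using fin X0 h by auto
  show ?thesis
  proof (rule that[of ?P])
    have "card ?P = (\<Sum>x\<in>X0. card (h x))" using f by simp
    also have "\<dots> \<le> (\<Sum>x\<in>X0. q)" using f by (intro sum_mono) auto
    also have "\<dots> \<le> q * q" using f by simp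
    finally show "card ?P \<le> q * q" .
    show "\<exists>(x, y)\<in>?P. x \<in> X \<and> y \<in> X" if "X \<in> S" for X
      using S[OF X0 that] S[OF h(1) that] by blast
  qed (use f h in auto)
qed

section \<open>Contracting a pair\<close>

lemma stirling_Suc: "stirling (Suc m) l = m * stirling m l + (if l = 0 then 0 else stirling m (l - 1))"
  by (cases l; cases m) auto

text \<open>Combinatorially, both sides compare with the number of permutations of
  \<open>m + 1\<close> points with \<open>l + 1\<close> cycles and a marked fixed point: each has at
  most \<open>l + 1\<close> fixed points. The proof is an induction on the recurrence.\<close>

lemma stirling_shift: "Suc m * stirling m l \<le> Suc l * stirling (Suc m) (Suc l)"
proof (induction m arbitrary: l)
  case 0
  show ?case by (cases l) auto
next
  case (Suc m)
  define a where "a = stirling m l"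
  define b where "b = stirling (Suc m) l"
  define c where "c = stirling (Suc m) (Suc l)"
  have 1: "Suc m * a \<le> Suc l * c" using Suc[of l] by (simp add: a_def c_def)
  have 2: "Suc m * b \<le> Suc m * m * a + l * b"
  proof (cases l)
    case (Suc l')
    then show ?thesis using Suc.IH[of l'] by (simp add: a_def b_def algebra_simps)
  qed (simp add: a_def b_def)
  have "Suc (Suc m) * b \<le> Suc m * m * a + l * b + b" using 2 by simp
  also have "\<dots> \<le> Suc m * (Suc m * a) + Suc l * b" by (simp add: algebra_simps)
  also have "\<dots> \<le> Suc m * (Suc l * c) + Suc l * b" using 1 by (intro add_mono mult_left_mono) auto
  also have "\<dots> = Suc l * stirling (Suc (Suc m)) (Suc l)" by (simp add: b_def c_def algebra_simps)
  finally show ?case by (simp add: b_def)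
qed

text \<open>A general ground set replaces \<open>{1..n}\<close> because deleting points does not
  leave an initial segment.\<close>

definition perms_cycles :: "'a set \<Rightarrow> nat \<Rightarrow> ('a \<Rightarrow> 'a) set" where
  "perms_cycles V k = {\<sigma>. \<sigma> permutes V \<and> card (orbit \<sigma> ` V) = k}"

lemma Sym_eq_perms_cycles: "Sym n k = perms_cycles {1..n} k"
  by (simp add: Sym_def perms_cycles_def cycles_on_def)

lemma finite_perms_cycles: "finite V \<Longrightarrow> finite (perms_cycles V k)"
  unfolding perms_cycles_def by (rule finite_subset[OF _ finite_permutations]) auto

text \<open>For \<open>b = a\<close> the new point forms its own orbit; otherwise it joins the orbit
  of \<open>b\<close>, and no two orbits are merged.\<close>

lemma card_orbits_transpose:
  assumes p: "p permutes S" and S: "finite S" "a \<notin> S" and b: "b \<in> insert a S"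
  shows "card (orbit (transpose a b \<circ> p) ` insert a S) =
    (if b = a then Suc (card (orbit p ` S)) else card (orbit p ` S))"
proof (cases "b = a")
  case True
  have "orbit p a = {a}"
    using p S by (simp add: orbit_eq_singleton_iff permutes_not_in)
  moreover have "{a} \<notin> orbit p ` S"
    using orbit_subset_permutes[OF p] S by fastforce
  ultimately show ?thesis
    using True S by (simp add: comp_def)
next
  case False
  with b have b: "b \<in> S" by auto
  let ?q = "transpose a b \<circ> p"
  let ?g = "\<lambda>Z. if b \<in> Z then insert a Z else Z"
  have o: "orbit ?q y = ?g (orbit p y)" if "y \<in> S" for y
    using orbit_transpose_comp[OF p S b that] .
  have "?q permutes insert a S"
    using permutes_compose[OF permutes_subset[OF p, of "insert a S"] permutes_swap_id[of a "insert a S" b]] b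
    by auto
  then have perm: "permutation ?q"
    using S by (auto simp: permutation_permutes)
  have "?q a = b" using p S by (simp add: permutes_not_in)
  then have "orbit ?q a = orbit ?q b"
    using permutation_orbit_step[OF perm, of a] by simp
  then have "orbit ?q ` insert a S = orbit ?q ` S"
    using b by auto
  also have "\<dots> = ?g ` orbit p ` S"
    unfolding image_image using o by (intro image_cong) auto
  finally have "orbit ?q ` insert a S = ?g ` orbit p ` S" .
  moreover have "inj_on ?g (orbit p ` S)"
  proof (rule inj_onI)
    fix X Y assume "X \<in> orbit p ` S" "Y \<in> orbit p ` S" and e: "?g X = ?g Y"
    then have "a \<notin> X" "a \<notin> Y"
      using orbit_subset_permutes[OF p] S by fastforce+
    then show "X = Y" using e by (auto simp: insert_ident split: if_splits)
  qed
  ultimately have "card (orbit ?q ` insert a S) = card (orbit p ` S)"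
    by (simp only: card_image)
  then show ?thesis using False by simp
qed

text \<open>
  Deleting \<open>a\<close> from its cycle identifies the permutations sending \<open>a\<close> to \<open>b\<close> with the permutations
  of the remaining points.
\<close>

lemma bij_betw_contract:
  assumes V: "finite V" "a \<in> V" "b \<in> V" and k: "a = b \<Longrightarrow> k \<ge> 1"
  shows "bij_betw (\<lambda>p. transpose a b \<circ> p) (perms_cycles (V - {a}) (if a = b then k - 1 else k))
    {\<sigma> \<in> perms_cycles V k. \<sigma> a = b}"
proof (rule bij_betw_byWitness[where f' = "\<lambda>p. transpose a b \<circ> p"])
  have inv: "transpose a b \<circ> (transpose a b \<circ> p) = p" for p
    by (simp flip: comp_assoc)
  then show "\<forall>p\<in>perms_cycles (V - {a}) (if a = b then k - 1 else k). transpose a b \<circ> (transpose a b \<circ> p) = p"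
    "\<forall>p\<in>{\<sigma> \<in> perms_cycles V k. \<sigma> a = b}. transpose a b \<circ> (transpose a b \<circ> p) = p" by auto
  have V': "insert a (V - {a}) = V" "finite (V - {a})" "a \<notin> V - {a}" using V by auto
  have card: "card (orbit (transpose a b \<circ> p) ` V) =
    (if b = a then Suc (card (orbit p ` (V - {a}))) else card (orbit p ` (V - {a})))"
    if "p permutes V - {a}" for p
    using card_orbits_transpose[OF that V'(2,3), of b] V' V by auto
  show "(\<lambda>p. transpose a b \<circ> p) ` perms_cycles (V - {a}) (if a = b then k - 1 else k) \<subseteq> {\<sigma> \<in> perms_cycles V k. \<sigma> a = b}"
  proof (rule image_subsetI)
    fix p assume p: "p \<in> perms_cycles (V - {a}) (if a = b then k - 1 else k)"
    then have pp: "p permutes V - {a}" by (simp add: perms_cycles_def)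
    have "(transpose a b \<circ> p) a = b" using permutes_not_in[OF pp, of a] by simp
    moreover have "transpose a b \<circ> p permutes V"
      using permutes_compose[OF permutes_subset[OF pp, of V] permutes_swap_id[OF V(2,3)]] by auto
    ultimately show "transpose a b \<circ> p \<in> {\<sigma> \<in> perms_cycles V k. \<sigma> a = b}"
      using p k card[OF pp] by (auto simp: perms_cycles_def)
  qed
  show "(\<lambda>p. transpose a b \<circ> p) ` {\<sigma> \<in> perms_cycles V k. \<sigma> a = b} \<subseteq> perms_cycles (V - {a}) (if a = b then k - 1 else k)"
  proof (rule image_subsetI)
    fix \<sigma> assume s: "\<sigma> \<in> {\<sigma> \<in> perms_cycles V k. \<sigma> a = b}"
    then have sp: "\<sigma> permutes V" by (simp add: perms_cycles_def)
    let ?p = "transpose a b \<circ> \<sigma>"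
    have "?p permutes insert a (V - {a})"
      using permutes_compose[OF sp permutes_swap_id[OF V(2,3)]] V' by simp
    then have pp: "?p permutes V - {a}"
      by (rule permutes_superset) (use s in auto)
    show "?p \<in> perms_cycles (V - {a}) (if a = b then k - 1 else k)"
      using card[OF pp, unfolded inv] pp s by (cases "a = b") (auto simp: perms_cycles_def)
  qed
qed

text \<open>Sorting the permutations by the image of one point \<open>a\<close> reproduces the
  Stirling recurrence, the image \<open>b = a\<close> giving the term with one cycle fewer.\<close>

lemma card_perms_cycles: "finite V \<Longrightarrow> card (perms_cycles V k) = stirling (card V) k"
proof (induction "card V" arbitrary: V k)
  case 0
  then show ?case by (cases k) (auto simp: perms_cycles_def)
next
  case (Suc m)
  then obtain a where a: "a \<in> V" by (metis card_eq_SucD insertI1)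
  let ?N = "\<lambda>b. {\<sigma> \<in> perms_cycles V k. \<sigma> a = b}"
  have m: "card (V - {a}) = m" using Suc a by simp
  have N: "card (?N b) = (if a = b then if k = 0 then 0 else stirling m (k - 1) else stirling m k)" if "b \<in> V" for b
  proof (cases "a = b \<and> k = 0")
    case True
    have "finite V" "V \<noteq> {}" using Suc a by auto
    then have "perms_cycles V k = {}" using True by (auto simp: perms_cycles_def)
    then show ?thesis using True by simp
  next
    case False
    then have "card (?N b) = card (perms_cycles (V - {a}) (if a = b then k - 1 else k))"
      using bij_betw_same_card[OF bij_betw_contract[OF Suc.prems a that, of k]] by auto
    then show ?thesis using Suc.hyps(1)[of "V - {a}"] m Suc.prems False by auto
  qed
  have "(\<Union>b\<in>V. ?N b) = perms_cycles V k"
    using a by (auto simp: perms_cycles_def permutes_in_image)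
  moreover have "card (\<Union>b\<in>V. ?N b) = (\<Sum>b\<in>V. card (?N b))"
    using Suc.prems finite_perms_cycles[OF Suc.prems, of k] by (intro card_UN_disjoint) auto
  ultimately have "card (perms_cycles V k) = (\<Sum>b\<in>V. card (?N b))" by simp
  also have "\<dots> = (\<Sum>b\<in>V. if a = b then if k = 0 then 0 else stirling m (k - 1) else stirling m k)"
    by (intro sum.cong N) auto
  also have "\<dots> = stirling (Suc m) k"
  proof -
    have "(\<Sum>b\<in>V - {a}. if a = b then if k = 0 then 0 else stirling m (k - 1) else stirling m k)
        = (\<Sum>b\<in>V - {a}. stirling m k)" by (intro sum.cong) auto
    then show ?thesis
      using m by (subst sum.remove[OF Suc.prems a]) (simp add: stirling_Suc)
  qed
  finally show ?case using Suc(2) by simp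
qed

text \<open>This mirrors on pairs the deletion of \<open>a\<close> from its cycle. Once
  \<open>a\<close> goes to \<open>b\<close>, no other pair starting at \<open>a\<close> or ending in
  \<open>b\<close> can be met, and a point formerly sent to \<open>a\<close> is now sent to
  \<open>b\<close>.\<close>

definition contract :: "'a \<Rightarrow> 'a \<Rightarrow> ('a \<times> 'a) set \<Rightarrow> ('a \<times> 'a) set" where
  "contract a b P = (\<lambda>(x, y). (x, if y = a then b else y)) ` {(x, y) \<in> P. x \<noteq> a \<and> y \<noteq> b}"

text \<open>These are graphs of partial injections. Partial ones are needed because contracting a
  permutation graph at a pair outside it loses two pairs but only one point.\<close>

definition matching :: "'a set \<Rightarrow> ('a \<times> 'a) set \<Rightarrow> bool" where
  "matching V P \<longleftrightarrow> P \<subseteq> V \<times> V \<and> inj_on fst P \<and> inj_on snd P"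

definition gr :: "'a set \<Rightarrow> ('a \<Rightarrow> 'a) \<Rightarrow> ('a \<times> 'a) set" where
  "gr V \<sigma> = (\<lambda>x. (x, \<sigma> x)) ` V"

lemma matching_gr: "\<sigma> permutes V \<Longrightarrow> matching V (gr V \<sigma>)"
  using permutes_inj[of \<sigma> V] by (auto simp: matching_def gr_def inj_on_def permutes_in_image dest: injD)

lemma matching_subset: "matching V P \<Longrightarrow> Q \<subseteq> P \<Longrightarrow> matching V Q"
  by (auto simp: matching_def intro: inj_on_subset)

lemma finite_matching: "matching V P \<Longrightarrow> finite V \<Longrightarrow> finite P"
  by (auto simp: matching_def intro: finite_subset)

lemma card_matching_le: "matching V P \<Longrightarrow> finite V \<Longrightarrow> card P \<le> card V"
  by (rule card_inj_on_le[of fst]) (auto simp: matching_def)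

lemma matching_eq_iff:
  assumes "matching V P" "(x, y) \<in> P" "(x', y') \<in> P"
  shows "x = x' \<longleftrightarrow> y = y'"
  using assms inj_onD[of fst P "(x, y)" "(x', y')"] inj_onD[of snd P "(x, y)" "(x', y')"]
  by (auto simp: matching_def)

lemma inj_on_contract:
  assumes "matching V P"
  shows "inj_on (\<lambda>(x, y). (x, if y = a then b else y)) {(x, y) \<in> P. x \<noteq> a \<and> y \<noteq> b}"
proof (rule inj_onI)
  fix u v
  assume uv: "u \<in> {(x, y) \<in> P. x \<noteq> a \<and> y \<noteq> b}" "v \<in> {(x, y) \<in> P. x \<noteq> a \<and> y \<noteq> b}"
    and e: "(\<lambda>(x, y). (x, if y = a then b else y)) u = (\<lambda>(x, y). (x, if y = a then b else y)) v"
  obtain x y x' y' where "u = (x, y)" "v = (x', y')" by (metis surj_pair)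
  then show "u = v" using uv e matching_eq_iff[OF assms, of x y x' y'] by simp
qed

lemma matching_contract:
  assumes "matching V P" "b \<in> V"
  shows "matching (V - {a}) (contract a b P)"
proof -
  have "inj_on fst (contract a b P)"
    unfolding contract_def inj_on_def using matching_eq_iff[OF assms(1)] by (auto split: if_splits)
  moreover have "inj_on snd (contract a b P)"
    unfolding contract_def inj_on_def using matching_eq_iff[OF assms(1)] by (auto split: if_splits)
  moreover have "contract a b P \<subseteq> (V - {a}) \<times> (V - {a})"
    using assms by (auto simp: contract_def matching_def split: if_splits)
  ultimately show ?thesis by (simp add: matching_def)
qed

lemma card_contract:
  assumes P: "matching V P" "finite V" and e: "(a, b) \<in> P"
  shows "card (contract a b P) = card P - 1"
proof -
  have "{(x, y) \<in> P. x \<noteq> a \<and> y \<noteq> b} = P - {(a, b)}"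
    using matching_eq_iff[OF P(1) e] by auto
  then show ?thesis
    using inj_on_contract[OF P(1), of a b] finite_matching[OF P] e
    by (simp add: contract_def card_image)
qed

text \<open>For \<open>x \<noteq> a\<close> the value \<open>p x\<close> is never \<open>a\<close>,
  so the transposition changes it only from \<open>b\<close> to \<open>a\<close>. Agreements other
  than \<open>(a, b)\<close> thus survive contraction, and no new ones appear.\<close>

lemma gr_contract:
  assumes s: "p permutes V - {a}" and ab: "a \<in> V" "b \<in> V"
  shows "(\<lambda>(x, y). (x, if y = a then b else y)) ` (P \<inter> gr V (transpose a b \<circ> p) - {(a, b)}) = contract a b P \<inter> gr (V - {a}) p"
    (is "?f ` ?L = ?R")
proof -
  have pa: "p a = a" using s by (simp add: permutes_not_in)
  have pn: "p x \<noteq> a" if "x \<noteq> a" for x using s pa that by (metis permutes_inj injD)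
  show ?thesis
  proof (intro set_eqI iffI)
    fix z assume "z \<in> ?f ` ?L"
    then obtain x where x: "x \<in> V" "(x, transpose a b (p x)) \<in> P" "(x, transpose a b (p x)) \<noteq> (a, b)"
      and z: "z = ?f (x, transpose a b (p x))"
      unfolding gr_def by auto
    then have "x \<noteq> a" using pa by auto
    with x have x: "x \<in> V" "(x, transpose a b (p x)) \<in> P" "x \<noteq> a" by auto
    have t: "transpose a b (p x) \<noteq> b" using pn[OF x(3)] by (metis transpose_apply_second transpose_eq_iff)
    have "z = (x, p x)" using z pn[OF x(3)] by (auto simp: transpose_def)
    moreover have "z \<in> contract a b P" unfolding contract_def
      by (rule image_eqI[where x = "(x, transpose a b (p x))"]) (use x z t in auto)
    ultimately show "z \<in> ?R" using x by (auto simp: gr_def)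
  next
    fix z assume "z \<in> ?R"
    then obtain x y where x: "(x, y) \<in> P" "x \<noteq> a" "y \<noteq> b" "z = (x, if y = a then b else y)" "x \<in> V"
      "(if y = a then b else y) = p x" by (auto simp: contract_def gr_def)
    then have "transpose a b (p x) = y" by (auto simp: transpose_def split: if_splits)
    then have "(x, y) \<in> ?L" using x by (auto simp: gr_def)
    then show "z \<in> ?f ` ?L" using x(4) by force
  qed
qed

lemma card_gr_contract:
  assumes P: "matching V P" "finite V" and e: "a \<in> V" "b \<in> V" and s: "p permutes V - {a}"
  shows "card (P \<inter> gr V (transpose a b \<circ> p) - {(a, b)}) = card (contract a b P \<inter> gr (V - {a}) p)"
proof -
  let ?L = "P \<inter> gr V (transpose a b \<circ> p) - {(a, b)}"
  have "(transpose a b \<circ> p) permutes V"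
    using permutes_compose[OF permutes_subset[OF s, of V] permutes_swap_id[OF e]] by auto
  then have m: "matching V (gr V (transpose a b \<circ> p))" by (rule matching_gr)
  have pa: "p a = a" using s by (simp add: permutes_not_in)
  have "(a, b) \<in> gr V (transpose a b \<circ> p)" using e pa by (force simp: gr_def)
  then have "?L \<subseteq> {(x, y) \<in> P. x \<noteq> a \<and> y \<noteq> b}"
    using matching_eq_iff[OF m, of a b] by auto
  then show ?thesis
    using gr_contract[OF s e, of P] card_image[OF inj_on_subset[OF inj_on_contract[OF P(1), of a b]], of ?L]
    by simp
qed

section \<open>Factorial moments of the number of agreements\<close>

text \<open>The case \<open>a = b\<close>, \<open>l = 0\<close> is separate since
  \<open>l - 1\<close> would truncate to \<open>0\<close>, whereas the sum on the left is
  empty.\<close>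

lemma card_agree_reindex:
  fixes f :: "nat \<Rightarrow> real"
  assumes V: "finite V" "a \<in> V" "b \<in> V" and P: "matching V P"
  shows "(\<Sum>\<sigma> | \<sigma> \<in> perms_cycles V l \<and> \<sigma> a = b. f (card (P \<inter> gr V \<sigma> - {(a, b)}))) =
    (if a = b \<and> l = 0 then 0
     else \<Sum>p\<in>perms_cycles (V - {a}) (if a = b then l - 1 else l). f (card (contract a b P \<inter> gr (V - {a}) p)))"
proof (cases "a = b \<and> l = 0")
  case True
  have "V \<noteq> {}" using V by auto
  then have "{\<sigma>. \<sigma> \<in> perms_cycles V l \<and> \<sigma> a = b} = {}" using True V by (auto simp: perms_cycles_def)
  then show ?thesis using True by (simp only: sum.empty) simp
next
  case False
  have "(\<Sum>\<sigma>\<in>{\<sigma> \<in> perms_cycles V l. \<sigma> a = b}. f (card (P \<inter> gr V \<sigma> - {(a, b)}))) =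
    (\<Sum>p\<in>perms_cycles (V - {a}) (if a = b then l - 1 else l). f (card (P \<inter> gr V (transpose a b \<circ> p) - {(a, b)})))"
    by (rule sum.reindex_bij_betw[OF bij_betw_contract, symmetric]) (use V False in auto)
  also have "\<dots> = (\<Sum>p\<in>perms_cycles (V - {a}) (if a = b then l - 1 else l). f (card (contract a b P \<inter> gr (V - {a}) p)))"
  proof (rule sum.cong[OF refl])
    fix p assume "p \<in> perms_cycles (V - {a}) (if a = b then l - 1 else l)"
    then have "p permutes V - {a}" by (simp add: perms_cycles_def)
    from card_gr_contract[OF P V this]
    show "f (card (P \<inter> gr V (transpose a b \<circ> p) - {(a, b)})) = f (card (contract a b P \<inter> gr (V - {a}) p))"
      by simp
  qed
  finally show ?thesis using False by (simp only: if_False)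
qed

text \<open>This is the binomial moment of the number of agreements, that is, the factorial moment
  divided by \<open>fact t\<close>, without normalisation by the number of permutations.\<close>

definition moment :: "nat \<Rightarrow> 'a set \<Rightarrow> nat \<Rightarrow> ('a \<times> 'a) set \<Rightarrow> real" where
  "moment t V l P = (\<Sum>\<sigma>\<in>perms_cycles V l. real (card (P \<inter> gr V \<sigma>) choose t))"

text \<open>With \<open>X\<close> agreements,
  \<open>(t + 1) * (X choose (t + 1)) = X * ((X - 1) choose t)\<close>. The factor \<open>X\<close>
  becomes a sum over the agreeing pair, and contracting that pair leaves the other
  \<open>X - 1\<close> agreements.\<close>

lemma moment_Suc:
  assumes V: "finite V" and P: "matching V P"
  shows "real (Suc t) * moment (Suc t) V l P = (\<Sum>(a, b)\<in>P. if a = b \<and> l = 0 then 0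
    else moment t (V - {a}) (if a = b then l - 1 else l) (contract a b P))"
proof -
  have finP: "finite P" using P V finite_matching by blast
  have finC: "finite (perms_cycles V l)" using V by (rule finite_perms_cycles)
  let ?X = "\<lambda>\<sigma>. card (P \<inter> gr V \<sigma>)"
  have PV: "a \<in> V" "b \<in> V" if "(a, b) \<in> P" for a b using P that by (auto simp: matching_def)
  have "real (Suc t) * real (?X \<sigma> choose Suc t) = (\<Sum>e\<in>P. if e \<in> gr V \<sigma> then real (card (P \<inter> gr V \<sigma> - {e}) choose t) else 0)" for \<sigma>
  proof -
    have "real (Suc t) * real (?X \<sigma> choose Suc t) = real (?X \<sigma> * (?X \<sigma> - 1 choose t))"
      using binomial_absorption[of t "?X \<sigma>"] by (metis of_nat_mult)
    also have "\<dots> = (\<Sum>e\<in>P \<inter> gr V \<sigma>. real (?X \<sigma> - 1 choose t))" by simp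
    also have "\<dots> = (\<Sum>e\<in>P \<inter> gr V \<sigma>. real (card (P \<inter> gr V \<sigma> - {e}) choose t))"
      using finP by (intro sum.cong refl) simp
    also have "\<dots> = (\<Sum>e\<in>P. if e \<in> gr V \<sigma> then real (card (P \<inter> gr V \<sigma> - {e}) choose t) else 0)"
      using finP by (rule sum.inter_restrict)
    finally show ?thesis .
  qed
  then have "real (Suc t) * moment (Suc t) V l P =
    (\<Sum>\<sigma>\<in>perms_cycles V l. \<Sum>e\<in>P. if e \<in> gr V \<sigma> then real (card (P \<inter> gr V \<sigma> - {e}) choose t) else 0)"
    unfolding moment_def sum_distrib_left by simp
  also have "\<dots> = (\<Sum>e\<in>P. \<Sum>\<sigma>\<in>perms_cycles V l. if e \<in> gr V \<sigma> then real (card (P \<inter> gr V \<sigma> - {e}) choose t) else 0)"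
    by (rule sum.swap)
  also have "\<dots> = (\<Sum>e\<in>P. \<Sum>\<sigma>\<in>{\<sigma> \<in> perms_cycles V l. e \<in> gr V \<sigma>}. real (card (P \<inter> gr V \<sigma> - {e}) choose t))"
    by (simp only: sum.inter_filter[OF finC])
  also have "\<dots> = (\<Sum>(a, b)\<in>P. if a = b \<and> l = 0 then 0
    else moment t (V - {a}) (if a = b then l - 1 else l) (contract a b P))"
  proof (rule sum.cong[OF refl])
    fix e assume e: "e \<in> P"
    obtain a b where ab: "e = (a, b)" by (cases e)
    have "{\<sigma> \<in> perms_cycles V l. e \<in> gr V \<sigma>} = {\<sigma>. \<sigma> \<in> perms_cycles V l \<and> \<sigma> a = b}"
      using PV e ab by (auto simp: gr_def)
    then show "(\<Sum>\<sigma>\<in>{\<sigma> \<in> perms_cycles V l. e \<in> gr V \<sigma>}. real (card (P \<inter> gr V \<sigma> - {e}) choose t)) =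
      (case e of (a, b) \<Rightarrow> if a = b \<and> l = 0 then 0
        else moment t (V - {a}) (if a = b then l - 1 else l) (contract a b P))"
      using card_agree_reindex[OF V _ _ P, of a b "\<lambda>x. real (x choose t)" l] PV e ab
      by (simp only: moment_def case_prod_conv)
  qed
  finally show ?thesis .
qed

text \<open>
  Loops are the only pairs whose contraction costs a cycle. A contraction creates at most one new
  loop, so after boundedly many steps there are still too few loops to matter.
\<close>

definition loops :: "('a \<times> 'a) set \<Rightarrow> nat" where
  "loops P = card {x. (x, x) \<in> P}"

text \<open>The only pair that can turn into a loop is \<open>(b, a)\<close>.\<close>

lemma loops_contract:
  assumes "finite P" shows "loops (contract a b P) \<le> Suc (loops P)"
proof -
  have fin: "finite {x. (x, x) \<in> P}"
    by (rule finite_subset[of _ "fst ` P"]) (use assms in force)+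
  have "{x. (x, x) \<in> contract a b P} \<subseteq> insert b {x. (x, x) \<in> P}"
    by (auto simp: contract_def split: if_splits)
  then have "loops (contract a b P) \<le> card (insert b {x. (x, x) \<in> P})"
    unfolding loops_def using fin by (intro card_mono) auto
  also have "\<dots> \<le> Suc (loops P)" unfolding loops_def using fin by (simp add: card_insert_if)
  finally show ?thesis .
qed

text \<open>For \<open>a\<close>, \<open>b\<close> in a set of \<open>m\<close> points this is the
  number of its permutations with \<open>l\<close> cycles that send \<open>a\<close> to
  \<open>b\<close>.\<close>

definition contracted_count :: "nat \<Rightarrow> nat \<Rightarrow> 'a \<Rightarrow> 'a \<Rightarrow> real" where
  "contracted_count m l a b = (if a = b \<and> l = 0 then 0 else real (stirling (m - 1) (if a = b then l - 1 else l)))"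

section \<open>Ratios of neighbouring Stirling numbers\<close>

lemma stirling_pred:
  assumes "m \<ge> 1" shows "real (stirling m l) = (real m - 1) * stirling (m - 1) l + (if l = 0 then 0 else stirling (m - 1) (l - 1))"
  using stirling_Suc[of "m - 1" l] assms by (auto simp: of_nat_diff)

lemma stirling_pred_loop:
  assumes "m \<ge> 1" "l \<ge> 1" shows "real m * stirling (m - 1) (l - 1) \<le> real l * stirling m l"
proof -
  obtain m' l' where "m = Suc m'" "l = Suc l'" using assms by (metis Suc_le_D One_nat_def)
  moreover have "real (Suc m' * stirling m' l') \<le> real (Suc l' * stirling (Suc m') (Suc l'))"
    using stirling_shift by (simp only: of_nat_le_iff)
  ultimately show ?thesis by (simp only: of_nat_mult diff_Suc_1)
qed

lemma stirling_pred_upper: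
  assumes "m \<ge> 1" shows "(real m - 1) * stirling (m - 1) l \<le> stirling m l"
  using stirling_pred[OF assms, of l] by simp

text \<open>The other term of the recurrence counts permutations fixing a given point, a share of at
  most \<open>l / m\<close>.\<close>

lemma stirling_pred_lower:
  assumes "m \<ge> 1" shows "(1 - real l / m) * stirling m l \<le> (real m - 1) * stirling (m - 1) l"
proof (cases "l = 0")
  case False
  then have "real (stirling (m - 1) (l - 1)) \<le> real l / m * stirling m l"
    using stirling_pred_loop[of m l] assms by (simp add: field_simps)
  then show ?thesis
    unfolding left_diff_distrib mult_1 using stirling_pred[OF assms, of l] False by (simp add: left_diff_distrib)
qed (use stirling_pred[OF assms, of l] in simp)

text \<open>A loop has density at most \<open>l / m\<close>. Any other pair has density at most
  \<open>1 / (m - 1)\<close>, which is at most \<open>2 / m\<close> as two distinct points are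
  present.\<close>

lemma contracted_count_le:
  assumes "a \<in> V" "b \<in> V" "finite V" "l \<le> k" "k \<ge> 1"
  shows "real (card V) * contracted_count (card V) l a b \<le> 2 * real k * stirling (card V) l"
proof -
  have V1: "card V \<ge> 1" using assms by (metis One_nat_def Suc_leI card_gt_0_iff empty_iff)
  show ?thesis
  proof (cases "a = b")
    case True
    show ?thesis
    proof (cases "l = 0")
      case False
      then have "real (card V) * stirling (card V - 1) (l - 1) \<le> real l * stirling (card V) l"
        using V1 by (intro stirling_pred_loop) auto
      also have "\<dots> \<le> 2 * real k * stirling (card V) l" using assms by (intro mult_right_mono) auto
      finally show ?thesis using True False by (simp add: contracted_count_def)
    qed (simp add: contracted_count_def True)
  next
    case False
    then have "card {a, b} \<le> card V" using assms by (intro card_mono) auto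
    then have "real (card V) * stirling (card V - 1) l \<le> (2 * (real (card V) - 1)) * stirling (card V - 1) l"
      using False by (intro mult_right_mono) auto
    also have "\<dots> \<le> 2 * real (stirling (card V) l)" 
      unfolding mult.assoc using stirling_pred_upper[OF V1, of l] by linarith
    also have "\<dots> \<le> 2 * real k * stirling (card V) l" using assms by (intro mult_right_mono) auto
    finally show ?thesis using False by (simp add: contracted_count_def)
  qed
qed

lemma sum_contracted_split:
  assumes "finite P"
  shows "(\<Sum>(a, b)\<in>P. contracted_count m l a b) = (card P - real (loops P)) * stirling (m - 1) l
    + real (loops P) * (if l = 0 then 0 else stirling (m - 1) (l - 1))"
proof -
  let ?L = "(\<lambda>x. (x, x)) ` {x. (x, x) \<in> P}"
  have fin: "finite {x. (x, x) \<in> P}"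
    by (rule finite_subset[of _ "fst ` P"]) (use assms in force)+
  have L: "?L \<subseteq> P" by auto
  have cL: "card ?L = loops P" unfolding loops_def by (rule card_image) (auto simp: inj_on_def)
  have "(\<Sum>(a, b)\<in>P. contracted_count m l a b) =
     (\<Sum>(a, b)\<in>P - ?L. contracted_count m l a b) + (\<Sum>(a, b)\<in>?L. contracted_count m l a b)"
    using assms L by (rule sum.subset_diff[rotated])
  also have "(\<Sum>(a, b)\<in>P - ?L. contracted_count m l a b) = (\<Sum>(a, b)\<in>P - ?L. real (stirling (m - 1) l))"
    by (intro sum.cong) (auto simp: contracted_count_def)
  also have "\<dots> = (card P - real (loops P)) * stirling (m - 1) l"
    using card_Diff_subset[OF finite_subset[OF L assms] L] card_mono[OF assms L] cL
    by (simp add: case_prod_beta of_nat_diff)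
  also have "(\<Sum>(a, b)\<in>?L. contracted_count m l a b) = (\<Sum>(a, b)\<in>?L. real (if l = 0 then 0 else stirling (m - 1) (l - 1)))"
    by (intro sum.cong) (auto simp: contracted_count_def)
  also have "\<dots> = real (loops P) * (if l = 0 then 0 else stirling (m - 1) (l - 1))"
    using cL by (simp add: case_prod_beta)
  finally show ?thesis .
qed

text \<open>Relative to \<open>stirling m l\<close> with \<open>m = card V\<close>, the non-loops
  give at most \<open>m / (m - 1)\<close> and the loops at most \<open>L * k / m\<close>. Both
  bounds decrease in \<open>m\<close>, so the error is evaluated at \<open>n0\<close>.\<close>

lemma sum_contracted_upper:
  assumes V: "finite V" "matching V P" and m: "card V \<ge> n0" "n0 \<ge> 2" and L: "loops P \<le> L" and l: "l \<le> k"
    and eps: "1 / (real n0 - 1) + real L * real k / real n0 \<le> \<epsilon>"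
  shows "(\<Sum>(a, b)\<in>P. contracted_count (card V) l a b) \<le> (1 + \<epsilon>) * stirling (card V) l"
proof -
  let ?m = "card V" and ?s = "real (stirling (card V) l)"
  have P: "finite P" "card P \<le> ?m" using V finite_matching card_matching_le by blast+
  have "(\<Sum>(a, b)\<in>P. contracted_count ?m l a b) \<le> real ?m * stirling (?m - 1) l
    + real L * (if l = 0 then 0 else stirling (?m - 1) (l - 1))"
    unfolding sum_contracted_split[OF P(1)] using P L by (intro add_mono mult_right_mono) auto
  also have "\<dots> \<le> real ?m / (real ?m - 1) * ?s + real L * (real k / real ?m * ?s)"
  proof (intro add_mono mult_left_mono)
    have "real ?m * stirling (?m - 1) l = real ?m / (real ?m - 1) * ((real ?m - 1) * stirling (?m - 1) l)"
      using m by simp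
    also have "\<dots> \<le> real ?m / (real ?m - 1) * ?s"
      using m by (intro mult_left_mono stirling_pred_upper) auto
    finally show "real ?m * stirling (?m - 1) l \<le> real ?m / (real ?m - 1) * ?s" .
    show "(if l = 0 then 0 else stirling (?m - 1) (l - 1)) \<le> real k / real ?m * ?s"
    proof (cases "l = 0")
      case False
      then have "real ?m * stirling (?m - 1) (l - 1) \<le> real l * ?s" using m by (intro stirling_pred_loop) auto
      also have "\<dots> \<le> real k * ?s" using l by (intro mult_right_mono) auto
      finally show ?thesis using False m by (simp add: field_simps)
    qed simp
  qed auto
  also have "\<dots> = (1 + (1 / (real ?m - 1) + real L * real k / real ?m)) * ?s"
    using m by (simp add: field_simps)
  also have "\<dots> \<le> (1 + (1 / (real n0 - 1) + real L * real k / real n0)) * ?s"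
    using m by (intro mult_right_mono add_mono divide_left_mono) auto
  also have "\<dots> \<le> (1 + \<epsilon>) * ?s" using eps by (intro mult_right_mono) auto
  finally show ?thesis .
qed

text \<open>Loops are dropped. At least \<open>m - 1 - L\<close> pairs remain, where
  \<open>m = card V\<close>, and the loss is \<open>(1 - u) * (1 - v)\<close> with \<open>u\<close>
  from the missing pairs and \<open>v\<close> from the Stirling ratio.\<close>

lemma sum_contracted_lower:
  assumes V: "finite V" "matching V P" and m: "card V \<ge> n0" "n0 \<ge> 2" and L: "loops P \<le> L" and l: "l \<le> k"
    and cP: "card V \<le> Suc (card P)"
    and eps: "real L / (real n0 - 1) + real k / real n0 \<le> \<epsilon>" "\<epsilon> \<le> 1"
  shows "(1 - \<epsilon>) * stirling (card V) l \<le> (\<Sum>(a, b)\<in>P. contracted_count (card V) l a b)"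
proof -
  let ?m = "card V" and ?s = "real (stirling (card V) l)"
  define u where "u = real L / (real ?m - 1)"
  define v where "v = real l / real ?m"
  have u: "0 \<le> u" "u \<le> real L / (real n0 - 1)" using m unfolding u_def by (auto intro!: divide_left_mono)
  have "v \<le> real k / real ?m" using m l unfolding v_def by (intro divide_right_mono) auto
  also have "\<dots> \<le> real k / real n0" using m by (intro divide_left_mono) auto
  finally have v: "0 \<le> v" "v \<le> real k / real n0" unfolding v_def by auto
  have uv: "u + v \<le> \<epsilon>" using u v eps by linarith
  have u1: "u \<le> 1" using uv v eps by linarith
  have P: "finite P" using V finite_matching by blast
  have "(1 - \<epsilon>) * ?s \<le> ((1 - u) * (1 - v)) * ?s"
  proof (rule mult_right_mono)
    have "u * v \<ge> 0" using u v by simp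
    then show "1 - \<epsilon> \<le> (1 - u) * (1 - v)" using uv by (simp add: algebra_simps)
  qed simp
  also have "\<dots> \<le> (1 - u) * ((real ?m - 1) * stirling (?m - 1) l)"
    using stirling_pred_lower[of ?m l] m u1 unfolding v_def mult.assoc by (intro mult_left_mono) auto
  also have "\<dots> = (real ?m - 1 - real L) * stirling (?m - 1) l"
    using m by (simp add: u_def field_simps)
  also have "\<dots> \<le> (card P - real (loops P)) * stirling (?m - 1) l" using L cP by (intro mult_right_mono) auto
  also have "\<dots> \<le> (\<Sum>(a, b)\<in>P. contracted_count ?m l a b)"
    unfolding sum_contracted_split[OF P(1)] by simp
  finally show ?thesis .
qed

lemma moment_0: "finite V \<Longrightarrow> moment 0 V l P = stirling (card V) l"
  by (simp add: moment_def card_perms_cycles)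

text \<open>Each contraction costs a factor \<open>1 + \<epsilon>\<close>, one point and at most one
  new loop. The summands \<open>t\<close> in the hypotheses on \<open>card V\<close> and
  \<open>loops P\<close> reserve room for all \<open>t\<close> steps.\<close>

lemma moment_upper:
  assumes "n0 \<ge> 2" "1 / (real n0 - 1) + real L * real k / real n0 \<le> \<epsilon>" "\<epsilon> \<ge> 0"
    and "finite V" "matching V P" "card V \<ge> n0 + t" "loops P + t \<le> L" "l \<le> k"
  shows "fact t * moment t V l P \<le> (1 + \<epsilon>) ^ t * stirling (card V) l"
  using assms(4-)
proof (induction t arbitrary: V l P)
  case (Suc t)
  have finP: "finite P" using Suc.prems finite_matching by blast
  have "fact (Suc t) * moment (Suc t) V l P = fact t * (real (Suc t) * moment (Suc t) V l P)"
    by (simp add: algebra_simps)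
  also have "\<dots> = (\<Sum>(a, b)\<in>P. if a = b \<and> l = 0 then 0
    else fact t * moment t (V - {a}) (if a = b then l - 1 else l) (contract a b P))"
    unfolding moment_Suc[OF Suc.prems(1,2)] sum_distrib_left by (intro sum.cong) auto
  also have "\<dots> \<le> (\<Sum>(a, b)\<in>P. (1 + \<epsilon>) ^ t * contracted_count (card V) l a b)"
  proof (rule sum_mono, clarify)
    fix a b assume ab: "(a, b) \<in> P"
    then have "a \<in> V" "b \<in> V" using Suc.prems by (auto simp: matching_def)
    then have "fact t * moment t (V - {a}) (if a = b then l - 1 else l) (contract a b P)
      \<le> (1 + \<epsilon>) ^ t * stirling (card (V - {a})) (if a = b then l - 1 else l)"
      using Suc.prems loops_contract[OF finP, of a b] by (intro Suc.IH matching_contract) auto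
    then show "(if a = b \<and> l = 0 then 0 else fact t * moment t (V - {a}) (if a = b then l - 1 else l) (contract a b P))
      \<le> (1 + \<epsilon>) ^ t * contracted_count (card V) l a b"
      using \<open>a \<in> V\<close> by (simp add: contracted_count_def)
  qed
  also have "\<dots> = (1 + \<epsilon>) ^ t * (\<Sum>(a, b)\<in>P. contracted_count (card V) l a b)"
    by (simp add: sum_distrib_left case_prod_beta)
  also have "\<dots> \<le> (1 + \<epsilon>) ^ t * ((1 + \<epsilon>) * stirling (card V) l)"
    using Suc.prems assms by (intro mult_left_mono sum_contracted_upper[where ?n0.0 = n0 and L = L and k = k]) auto
  finally show ?case by (simp add: algebra_simps)
qed (simp add: moment_0)

text \<open>As for the upper bound; in addition \<open>P\<close> stays at most one pair short of a
  full permutation graph, since contracting one of its pairs removes exactly one pair and one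
  point.\<close>

lemma moment_lower:
  assumes "n0 \<ge> 2" "real L / (real n0 - 1) + real k / real n0 \<le> \<epsilon>" "\<epsilon> \<le> 1"
    and "finite V" "matching V P" "card V \<ge> n0 + t" "loops P + t \<le> L" "l \<le> k" "card V \<le> Suc (card P)"
  shows "(1 - \<epsilon>) ^ t * stirling (card V) l \<le> fact t * moment t V l P"
  using assms(4-)
proof (induction t arbitrary: V l P)
  case (Suc t)
  have finP: "finite P" using Suc.prems finite_matching by blast
  have "(1 - \<epsilon>) ^ Suc t * stirling (card V) l = (1 - \<epsilon>) ^ t * ((1 - \<epsilon>) * stirling (card V) l)"
    by (simp add: algebra_simps)
  also have "\<dots> \<le> (1 - \<epsilon>) ^ t * (\<Sum>(a, b)\<in>P. contracted_count (card V) l a b)"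
    using Suc.prems assms by (intro mult_left_mono sum_contracted_lower[where ?n0.0 = n0 and L = L and k = k]) auto
  also have "\<dots> = (\<Sum>(a, b)\<in>P. (1 - \<epsilon>) ^ t * contracted_count (card V) l a b)"
    by (simp add: sum_distrib_left case_prod_beta)
  also have "\<dots> \<le> (\<Sum>(a, b)\<in>P. if a = b \<and> l = 0 then 0
    else fact t * moment t (V - {a}) (if a = b then l - 1 else l) (contract a b P))"
  proof (rule sum_mono, clarify)
    fix a b assume ab: "(a, b) \<in> P"
    then have aV: "a \<in> V" "b \<in> V" using Suc.prems by (auto simp: matching_def)
    have "card (contract a b P) = card P - 1" using card_contract[OF Suc.prems(2,1) ab] .
    moreover have "card P \<ge> 1" using finP ab by (metis One_nat_def Suc_leI card_gt_0_iff empty_iff)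
    ultimately have "(1 - \<epsilon>) ^ t * stirling (card (V - {a})) (if a = b then l - 1 else l)
      \<le> fact t * moment t (V - {a}) (if a = b then l - 1 else l) (contract a b P)"
      using Suc.prems loops_contract[OF finP, of a b] aV by (intro Suc.IH matching_contract) auto
    then show "(1 - \<epsilon>) ^ t * contracted_count (card V) l a b \<le>
       (if a = b \<and> l = 0 then 0 else fact t * moment t (V - {a}) (if a = b then l - 1 else l) (contract a b P))"
      using aV by (simp add: contracted_count_def)
  qed
  also have "\<dots> = fact t * (real (Suc t) * moment (Suc t) V l P)"
    unfolding moment_Suc[OF Suc.prems(1,2)] sum_distrib_left by (intro sum.cong) auto
  finally show ?case by (simp add: algebra_simps)
qed (simp add: moment_0)

text \<open>For \<open>x = y + 1\<close>, Pascal's rule telescopes the right-hand side to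
  \<open>1 + (y choose 3)\<close>.\<close>

lemma bonferroni_three: "(if x = 0 then 0 else 1) \<le> real (x choose 1) - real (x choose 2) + real (x choose 3)"
proof -
  have "real (Suc y choose 1) - real (Suc y choose 2) + real (Suc y choose 3) = 1 + real (y choose 3)" for y
    by (simp add: numeral_2_eq_2 numeral_3_eq_3)
  then show ?thesis by (cases x) (auto simp: numeral_2_eq_2 numeral_3_eq_3)
qed

text \<open>The first three binomial moments are close to \<open>1\<close>, \<open>1 / 2\<close> and
  \<open>1 / 6\<close> times the Stirling number. In the error the squares of
  \<open>\<epsilon>\<close> cancel, leaving
  \<open>5 / 2 * \<epsilon> + \<epsilon> ^ 3 / 6\<close>.\<close>

lemma card_agreeing_le:
  assumes n0: "n0 \<ge> 2" and eps: "1 / (real n0 - 1) + real L * real k / real n0 \<le> \<epsilon>"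
      "real L / (real n0 - 1) + real k / real n0 \<le> \<epsilon>" "0 \<le> \<epsilon>" "\<epsilon> \<le> 1"
    and V: "finite V" "matching V P" "card V \<ge> n0 + 3" "loops P + 3 \<le> L" "l \<le> k" "card V \<le> Suc (card P)"
  shows "card {\<sigma> \<in> perms_cycles V l. P \<inter> gr V \<sigma> \<noteq> {}} \<le> (2 / 3 + 3 * \<epsilon>) * stirling (card V) l"
proof -
  let ?s = "real (stirling (card V) l)"
  have fin: "finite P" "finite (perms_cycles V l)" using V finite_matching finite_perms_cycles by blast+
  have "real (card {\<sigma> \<in> perms_cycles V l. P \<inter> gr V \<sigma> \<noteq> {}}) =
    (\<Sum>\<sigma>\<in>perms_cycles V l. if card (P \<inter> gr V \<sigma>) = 0 then 0 else 1)"
  proof -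
    have "(\<Sum>\<sigma>\<in>perms_cycles V l. if card (P \<inter> gr V \<sigma>) = 0 then 0 else 1::real) =
      (\<Sum>\<sigma>\<in>perms_cycles V l. if P \<inter> gr V \<sigma> \<noteq> {} then 1 else 0)"
      using fin by (intro sum.cong) auto
    also have "\<dots> = (\<Sum>\<sigma>\<in>{\<sigma> \<in> perms_cycles V l. P \<inter> gr V \<sigma> \<noteq> {}}. 1)"
      by (rule sum.inter_filter[OF fin(2), symmetric])
    finally show ?thesis by simp
  qed
  also have "\<dots> \<le> moment 1 V l P - moment 2 V l P + moment 3 V l P"
    unfolding moment_def sum_subtractf[symmetric] sum.distrib[symmetric] by (intro sum_mono bonferroni_three)
  also have "\<dots> \<le> (1 + \<epsilon>) * ?s - (1 - \<epsilon>) ^ 2 * ?s / 2 + (1 + \<epsilon>) ^ 3 * ?s / 6"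
  proof -
    have "fact 1 * moment 1 V l P \<le> (1 + \<epsilon>) ^ 1 * ?s"
      by (rule moment_upper[OF n0 eps(1,3)]) (use V in auto)
    moreover have "(1 - \<epsilon>) ^ 2 * ?s \<le> fact 2 * moment 2 V l P"
      by (rule moment_lower[OF n0 eps(2,4)]) (use V in auto)
    moreover have "fact 3 * moment 3 V l P \<le> (1 + \<epsilon>) ^ 3 * ?s"
      by (rule moment_upper[OF n0 eps(1,3)]) (use V in auto)
    ultimately show ?thesis by (simp add: fact_numeral)
  qed
  also have "\<dots> = ((1 + \<epsilon>) - (1 - \<epsilon>) ^ 2 / 2 + (1 + \<epsilon>) ^ 3 / 6) * ?s"
    by (simp add: algebra_simps)
  also have "\<dots> \<le> (2 / 3 + 3 * \<epsilon>) * ?s"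
  proof (rule mult_right_mono)
    have "\<epsilon> * \<epsilon> \<le> 1" using eps(3,4) by (metis mult_le_one)
    then have "\<epsilon> * (\<epsilon> * \<epsilon>) \<le> \<epsilon>" using eps(3) by (rule mult_left_le)
    moreover have "(1 + \<epsilon>) - (1 - \<epsilon>) ^ 2 / 2 + (1 + \<epsilon>) ^ 3 / 6 = 2 / 3 + 5 / 2 * \<epsilon> + \<epsilon> * (\<epsilon> * \<epsilon>) / 6"
      by (simp add: power2_eq_square power3_eq_cube field_simps)
    ultimately show "(1 + \<epsilon>) - (1 - \<epsilon>) ^ 2 / 2 + (1 + \<epsilon>) ^ 3 / 6 \<le> 2 / 3 + 3 * \<epsilon>"
      using eps(3) by linarith
  qed simp
  finally show ?thesis .
qed

section \<open>Permutations containing prescribed pairs\<close>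

lemma finite_contract: "finite P \<Longrightarrow> finite (contract a b P)"
  unfolding contract_def by (rule finite_imageI, rule finite_subset[of _ P]) auto

text \<open>If all pairs of \<open>X\<close> are agreements, then counting shows the same for all
  pairs of its contraction.\<close>

lemma card_containing_contract:
  assumes V: "finite V" and ab: "(a, b) \<in> X" and X: "matching V X"
  shows "card {\<sigma> \<in> perms_cycles V l. X \<subseteq> gr V \<sigma>} \<le> (if a = b \<and> l = 0 then 0 else
    card {p \<in> perms_cycles (V - {a}) (if a = b then l - 1 else l). contract a b X \<subseteq> gr (V - {a}) p})"
proof -
  have aV: "a \<in> V" "b \<in> V" using ab X by (auto simp: matching_def)
  have finX: "finite X" using X V finite_matching by blast
  let ?A = "{\<sigma> \<in> perms_cycles V l. X \<subseteq> gr V \<sigma>}"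
  have sub: "?A \<subseteq> {\<sigma> \<in> perms_cycles V l. \<sigma> a = b}" using ab by (auto simp: gr_def)
  show ?thesis
  proof (cases "a = b \<and> l = 0")
    case True
    have "V \<noteq> {}" using aV by auto
    then have "?A = {}" using True V by (auto simp: perms_cycles_def)
    then show ?thesis by (simp only: card.empty)
  next
    case False
    let ?l = "if a = b then l - 1 else l"
    let ?B = "{p \<in> perms_cycles (V - {a}) ?l. contract a b X \<subseteq> gr (V - {a}) p}"
    have bij: "bij_betw (\<lambda>p. transpose a b \<circ> p) (perms_cycles (V - {a}) ?l) {\<sigma> \<in> perms_cycles V l. \<sigma> a = b}"
      using False V aV by (intro bij_betw_contract) auto
    have "?A \<subseteq> (\<lambda>p. transpose a b \<circ> p) ` ?B"
    proof
      fix \<sigma> assume s: "\<sigma> \<in> ?A"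
      then obtain p where p: "p \<in> perms_cycles (V - {a}) ?l" "\<sigma> = transpose a b \<circ> p"
        using bij_betw_imp_surj_on[OF bij] sub by blast
      then have pp: "p permutes V - {a}" by (simp add: perms_cycles_def)
      have "X \<inter> gr V \<sigma> = X" using s by auto
      then have "card (contract a b X \<inter> gr (V - {a}) p) = card (X - {(a, b)})"
        using card_gr_contract[OF X V aV pp] p(2) by simp
      also have "\<dots> = card (contract a b X)" using card_contract[OF X V ab] finX ab by simp
      finally have "contract a b X \<inter> gr (V - {a}) p = contract a b X"
        using finX by (intro card_subset_eq finite_contract) auto
      then show "\<sigma> \<in> (\<lambda>p. transpose a b \<circ> p) ` ?B" using p by auto
    qed
    moreover have finB: "finite ?B"
      by (rule finite_subset[OF _ finite_perms_cycles[of "V - {a}" ?l]]) (use V in auto)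
    ultimately have "card ?A \<le> card ((\<lambda>p. transpose a b \<circ> p) ` ?B)"
      by (intro card_mono finite_imageI)
    also have "\<dots> \<le> card ?B" by (rule card_image_le[OF finB])
    finally show ?thesis using False by (simp only: if_False)
  qed
qed

text \<open>Contracting the pairs of \<open>X\<close> one by one costs factors
  \<open>2 * k / m\<close>, \<open>2 * k / (m - 1)\<close> and so on, whose denominators form the
  quotient of factorials. Loops lower \<open>l\<close>, hence the induction allows every
  \<open>l \<le> k\<close>.\<close>

lemma card_containing_aux:
  assumes "k \<ge> 1"
  shows "finite V \<Longrightarrow> finite X \<Longrightarrow> l \<le> k \<Longrightarrow> real (card {\<sigma> \<in> perms_cycles V l. X \<subseteq> gr V \<sigma>}) * fact (card V)
    \<le> stirling (card V) l * (2 * real k) ^ card X * fact (card V - card X)"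
proof (induction "card X" arbitrary: V l X)
  case 0
  then show ?case by (simp add: card_perms_cycles)
next
  case (Suc t)
  show ?case
  proof (cases "{\<sigma> \<in> perms_cycles V l. X \<subseteq> gr V \<sigma>} = {}")
    case True
    show ?thesis unfolding True by simp
  next
    case False
    then obtain \<sigma> where s: "\<sigma> permutes V" "X \<subseteq> gr V \<sigma>" by (auto simp: perms_cycles_def)
    then have X: "matching V X" using matching_gr matching_subset by blast
    obtain a b where ab: "(a, b) \<in> X" using Suc(2) by (metis card_eq_SucD insertI1 surj_pair)
    have aV: "a \<in> V" "b \<in> V" using ab X by (auto simp: matching_def)
    let ?m = "card V" and ?l = "if a = b then l - 1 else l"
    let ?N' = "card {p \<in> perms_cycles (V - {a}) ?l. contract a b X \<subseteq> gr (V - {a}) p}"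
    have m: "?m \<ge> 1" using aV Suc.prems by (metis One_nat_def Suc_leI card_gt_0_iff empty_iff)
    have cV: "card (V - {a}) = ?m - 1" using aV Suc.prems by simp
    have cX: "card (contract a b X) = t" using card_contract[OF X Suc.prems(1) ab] Suc(2) by simp
    have "finite (contract a b X)" using Suc.prems by (intro finite_contract)
    then have IH: "real ?N' * fact (?m - 1) \<le> stirling (?m - 1) ?l * (2 * real k) ^ t * fact (?m - 1 - t)"
      using Suc.hyps(1)[of "contract a b X" "V - {a}" ?l] cX Suc.prems cV by auto
    have "real (card {\<sigma> \<in> perms_cycles V l. X \<subseteq> gr V \<sigma>}) * fact (?m - 1)
      \<le> (if a = b \<and> l = 0 then 0 else real ?N') * fact (?m - 1)"
      using card_containing_contract[OF Suc.prems(1) ab X, of l] by (intro mult_right_mono) auto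
    also have "\<dots> \<le> contracted_count ?m l a b * ((2 * real k) ^ t * fact (?m - 1 - t))"
      using IH by (simp add: contracted_count_def mult.assoc)
    finally have "real ?m * (real (card {\<sigma> \<in> perms_cycles V l. X \<subseteq> gr V \<sigma>}) * fact (?m - 1))
      \<le> real ?m * (contracted_count ?m l a b * ((2 * real k) ^ t * fact (?m - 1 - t)))"
      by (intro mult_left_mono) auto
    also have "\<dots> = (real ?m * contracted_count ?m l a b) * ((2 * real k) ^ t * fact (?m - 1 - t))"
      by (simp only: mult.assoc)
    also have "\<dots> \<le> (2 * real k * stirling ?m l) * ((2 * real k) ^ t * fact (?m - 1 - t))"
      using aV Suc.prems assms by (intro mult_right_mono contracted_count_le) auto
    also have "\<dots> = stirling ?m l * (2 * real k) ^ card X * fact (?m - card X)"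
      using Suc(2)[symmetric] by simp
    finally show ?thesis using m fact_reduce[of ?m, where ?'a = real] by (simp add: mult_ac)
  qed
qed

text \<open>With \<open>t\<close> pairs in \<open>X\<close>, the bounds
  \<open>(n / t) ^ t \<le> n choose t\<close> and \<open>t ^ t \<le> 3 ^ t * fact t\<close> show
  that the falling factorial is at least \<open>(n / 3) ^ t\<close>, which turns
  \<open>2 * k\<close> into \<open>6 * k / n\<close>.\<close>

lemma card_containing_le:
  assumes V: "finite V" "V \<noteq> {}" and X: "finite X" and k: "k \<ge> 1"
  shows "real (card {\<sigma> \<in> perms_cycles V k. X \<subseteq> gr V \<sigma>}) \<le> stirling (card V) k * (6 * real k / card V) ^ card X"
proof (cases "{\<sigma> \<in> perms_cycles V k. X \<subseteq> gr V \<sigma>} = {}")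
  case True
  show ?thesis unfolding True by simp
next
  case False
  let ?n = "card V" and ?t = "card X" and ?N = "real (card {\<sigma> \<in> perms_cycles V k. X \<subseteq> gr V \<sigma>})"
  obtain \<sigma> where "\<sigma> permutes V" "X \<subseteq> gr V \<sigma>" using False by (auto simp: perms_cycles_def)
  then have tn: "?t \<le> ?n" using matching_gr matching_subset card_matching_le V by metis
  have n0: "real ?n > 0" using V by (simp add: card_gt_0_iff)
  have "(real ?n / real ?t) ^ ?t \<le> real (?n choose ?t)" using binomial_ge_n_over_k_pow_k[OF tn] .
  then have "(real ?n / real ?t) ^ ?t * real ?t ^ ?t \<le> real (?n choose ?t) * (3 ^ ?t * fact ?t)"
    by (intro mult_mono power_self_le_fact) auto
  moreover have "(real ?n / real ?t) ^ ?t * real ?t ^ ?t = real ?n ^ ?t"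
    by (cases "?t = 0") (auto simp: power_divide)
  ultimately have "real ?n ^ ?t * fact (?n - ?t) \<le> (real (?n choose ?t) * (3 ^ ?t * fact ?t)) * fact (?n - ?t)"
    by (intro mult_right_mono) auto
  also have "\<dots> = 3 ^ ?t * fact ?n"
    using binomial_fact_lemma[OF tn] by (metis (no_types, lifting) mult.assoc mult.commute of_nat_fact of_nat_mult)
  finally have 1: "real ?n ^ ?t * fact (?n - ?t) \<le> 3 ^ ?t * fact ?n" .
  have "?N * fact ?n * real ?n ^ ?t \<le> (stirling ?n k * (2 * real k) ^ ?t * fact (?n - ?t)) * real ?n ^ ?t"
    using card_containing_aux[OF k V(1) X order_refl] by (intro mult_right_mono) auto
  also have "\<dots> = (stirling ?n k * (2 * real k) ^ ?t) * (real ?n ^ ?t * fact (?n - ?t))" by simp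
  also have "\<dots> \<le> (stirling ?n k * (2 * real k) ^ ?t) * (3 ^ ?t * fact ?n)" using 1 by (intro mult_left_mono) auto
  also have "\<dots> = (stirling ?n k * (6 * real k) ^ ?t) * fact ?n"
  proof -
    have "(6 * real k) ^ ?t = (2 * real k) ^ ?t * 3 ^ ?t" unfolding power_mult_distrib[symmetric] by simp
    then show ?thesis by (simp only: mult_ac)
  qed
  finally have "?N * real ?n ^ ?t \<le> stirling ?n k * (6 * real k) ^ ?t" by (simp add: mult_ac)
  then show ?thesis using n0 by (simp add: power_divide field_simps)
qed

text \<open>Error terms arise relative to all permutations but the target is the size of a largest
  star; the exchange costs a factor \<open>n\<close>.\<close>

lemma stirling_le_max:
  assumes "n \<ge> 1" "k \<ge> 1"
  shows "stirling n k \<le> n * max (stirling (n - 1) k) (stirling (n - 1) (k - 1))"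
proof -
  let ?M = "max (stirling (n - 1) k) (stirling (n - 1) (k - 1))"
  have "stirling n k = (n - 1) * stirling (n - 1) k + stirling (n - 1) (k - 1)"
    using stirling_Suc[of "n - 1" k] assms by simp
  also have "\<dots> \<le> (n - 1) * ?M + ?M" by (intro add_mono mult_left_mono) auto
  also have "\<dots> = n * ?M" using assms by (cases n) auto
  finally show ?thesis .
qed

text \<open>Loops are fixed points, and these form distinct singleton cycles.\<close>

lemma loops_gr:
  assumes V: "finite V" and t: "\<tau> \<in> perms_cycles V k"
  shows "loops (gr V \<tau>) \<le> k"
proof -
  have "inj_on (orbit \<tau>) {x \<in> V. \<tau> x = x}"
  proof (rule inj_onI)
    fix x y assume xy: "x \<in> {x \<in> V. \<tau> x = x}" "y \<in> {x \<in> V. \<tau> x = x}" "orbit \<tau> x = orbit \<tau> y"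
    have "orbit \<tau> x = {x}" "orbit \<tau> y = {y}" using xy(1,2) by (simp_all only: orbit_eq_singleton_iff mem_Collect_eq)
    then show "x = y" using xy(3) by (simp only: singleton_inject)
  qed
  then have "card {x \<in> V. \<tau> x = x} \<le> card (orbit \<tau> ` V)"
    by (rule card_inj_on_le) (use V in auto)
  also have "\<dots> = k" using t by (simp add: perms_cycles_def)
  also have "{x \<in> V. \<tau> x = x} = {x. (x, x) \<in> gr V \<tau>}" by (auto simp: gr_def)
  finally show ?thesis by (simp add: loops_def)
qed

text \<open>Contracting \<open>(i, j)\<close> turns the star into all permutations of the other
  points with the appropriate number of cycles. As \<open>(i, j)\<close> is not in the graph of
  \<open>\<tau>\<close>, every agreement with \<open>\<tau>\<close> survives.\<close>

lemma card_star_meeting_le: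
  assumes V: "finite V" "i \<in> V" "j \<in> V" "card V \<ge> 6" and k: "k \<ge> 1"
    and \<tau>: "\<tau> \<in> perms_cycles V k" "\<tau> i \<noteq> j"
    and eps: "1 / (real (card V) - 5) + (real k + 4) * real k / (real (card V) - 4) \<le> \<epsilon>"
      "(real k + 4) / (real (card V) - 5) + real k / (real (card V) - 4) \<le> \<epsilon>" "\<epsilon> \<le> 1"
  shows "real (card {\<sigma> \<in> perms_cycles V k. \<sigma> i = j \<and> gr V \<tau> \<inter> gr V \<sigma> \<noteq> {}})
    \<le> (2 / 3 + 3 * \<epsilon>) * stirling (card V - 1) (if i = j then k - 1 else k)"
proof -
  let ?l = "if i = j then k - 1 else k" and ?P = "contract i j (gr V \<tau>)" and ?V = "V - {i}"
  let ?A = "{\<sigma> \<in> perms_cycles V k. \<sigma> i = j \<and> gr V \<tau> \<inter> gr V \<sigma> \<noteq> {}}"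
  let ?B = "{p \<in> perms_cycles ?V ?l. ?P \<inter> gr ?V p \<noteq> {}}"
  have tp: "\<tau> permutes V" using \<tau> by (simp add: perms_cycles_def)
  have m: "matching V (gr V \<tau>)" by (rule matching_gr[OF tp])
  have fin: "finite (gr V \<tau>)" using V by (simp add: gr_def)
  have bij: "bij_betw (\<lambda>p. transpose i j \<circ> p) (perms_cycles ?V ?l) {\<sigma> \<in> perms_cycles V k. \<sigma> i = j}"
    using V k by (intro bij_betw_contract) auto
  have nij: "(i, j) \<notin> gr V \<tau>" using \<tau> by (auto simp: gr_def)
  have "?A \<subseteq> (\<lambda>p. transpose i j \<circ> p) ` ?B"
  proof
    fix \<sigma> assume s: "\<sigma> \<in> ?A"
    then obtain p where p: "p \<in> perms_cycles ?V ?l" "\<sigma> = transpose i j \<circ> p"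
      using bij_betw_imp_surj_on[OF bij] by blast
    then have pp: "p permutes V - {i}" by (simp add: perms_cycles_def)
    have "card (gr V \<tau> \<inter> gr V \<sigma>) > 0" using s fin by (simp add: card_gt_0_iff)
    moreover have "gr V \<tau> \<inter> gr V \<sigma> - {(i, j)} = gr V \<tau> \<inter> gr V \<sigma>" using nij by auto
    ultimately have "card (?P \<inter> gr ?V p) > 0" using card_gr_contract[OF m V(1-3) pp] p(2) by simp
    then have "?P \<inter> gr ?V p \<noteq> {}" by auto
    then show "\<sigma> \<in> (\<lambda>p. transpose i j \<circ> p) ` ?B" using p by auto
  qed
  moreover have finB: "finite ?B"
    by (rule finite_subset[OF _ finite_perms_cycles[of ?V ?l]]) (use V in auto)
  ultimately have "card ?A \<le> card ((\<lambda>p. transpose i j \<circ> p) ` ?B)"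
    by (intro card_mono finite_imageI)
  also have "\<dots> \<le> card ?B" by (rule card_image_le[OF finB])
  finally have "real (card ?A) \<le> card ?B" by simp
  also have "\<dots> \<le> (2 / 3 + 3 * \<epsilon>) * stirling (card ?V) ?l"
  \<comment> \<open>Three further contractions follow the one at \<open>(i, j)\<close>, so four
    points are lost and at most four loops are gained over the initial \<open>k\<close>.\<close>
  proof (rule card_agreeing_le[where ?n0.0 = "card V - 4" and L = "k + 4" and k = k])
    show "0 \<le> \<epsilon>" using V by (intro order_trans[OF _ eps(1)]) auto
    show "card ?V \<le> Suc (card ?P)"
    proof -
      \<comment> \<open>Contraction discards only the pair of \<open>\<tau>\<close> starting at
        \<open>i\<close> and the pair ending in \<open>j\<close>.\<close>
      let ?Q = "gr V \<tau> - {(i, \<tau> i), (inv \<tau> j, j)}"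
      have "?Q \<subseteq> {(x, y) \<in> gr V \<tau>. x \<noteq> i \<and> y \<noteq> j}"
        using permutes_inverses[OF tp] by (auto simp: gr_def)
      then have "card ?Q \<le> card {(x, y) \<in> gr V \<tau>. x \<noteq> i \<and> y \<noteq> j}"
        using fin by (intro card_mono) (auto intro: finite_subset)
      also have "\<dots> = card ?P"
        using card_image[OF inj_on_contract[OF m, of i j]] by (simp add: contract_def)
      finally have "card ?Q \<le> card ?P" .
      moreover have "card (gr V \<tau>) - card {(i, \<tau> i), (inv \<tau> j, j)} \<le> card ?Q" by (rule diff_card_le_card_Diff) auto
      moreover have "card {(i, \<tau> i), (inv \<tau> j, j)} \<le> 2" by (simp add: card_insert_if)
      moreover have "card (gr V \<tau>) = card V" unfolding gr_def by (rule card_image) (auto simp: inj_on_def)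
      ultimately show ?thesis using V by simp
    qed
    show "loops ?P + 3 \<le> k + 4" using loops_contract[OF fin, of i j] loops_gr[OF V(1) \<tau>(1)] by linarith
    show "matching ?V ?P" by (rule matching_contract[OF m V(3)])
    have r: "real (card V - 4) = real (card V) - 4" using V by simp
    have r': "real (card V) - 4 - 1 = real (card V) - 5" "real (k + 4) = real k + 4" by simp_all
    show "1 / (real (card V - 4) - 1) + real (k + 4) * real k / real (card V - 4) \<le> \<epsilon>"
      "real (k + 4) / (real (card V - 4) - 1) + real k / real (card V - 4) \<le> \<epsilon>"
      unfolding r r' by (rule eps)+
    show "\<epsilon> \<le> 1" by (rule eps)
    show "2 \<le> card V - 4" "card V - 4 + 3 \<le> card ?V" "finite ?V" using V by auto
    show "?l \<le> k" by simp
  qed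
  finally show ?thesis using V by simp
qed

section \<open>Non-centred intersecting families\<close>

text \<open>
  With \<open>y\<close> the eighth root of \<open>n\<close> all quantities are powers of \<open>y\<close>: the family of all permutations is
  spread with parameter \<open>y^6 / 6\<close>, we ask for cores with parameter \<open>R = y^5\<close>, and cores of size at most
  \<open>15\<close> make the remainder \<open>(6 / y)^16\<close> times \<open>stirling n k\<close>, which beats the loss of a factor \<open>n = y^8\<close>.
\<close>

lemma card_non_centred_le:
  fixes y :: real
  assumes y: "y \<ge> 200" "real n = y ^ 8" and k: "k \<ge> 1" "real k \<le> y ^ 2"
    and F: "F \<subseteq> Sym n k" "intersecting n F" "\<not> centred n k F"
  shows "real (card F) \<le> (2 / 3 + (8100 / y ^ 4 + 6 ^ 16 / y ^ 8)) * real (max (stirling (n - 1) k) (stirling (n - 1) (k - 1)))"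
proof -
  define V where "V = {1..n}"
  define g where "g = gr V"
  define M where "M = real (max (stirling (n - 1) k) (stirling (n - 1) (k - 1)))"
  define S where "S = spread_cores (y ^ 5) 15 g F"
  define F' where "F' = {\<sigma> \<in> F. \<forall>X\<in>S. \<not> X \<subseteq> g \<sigma>}"
  have M0: "M \<ge> 0" by (simp add: M_def)
  have y0: "y > 0" using y by simp
  have "real n > 0" unfolding y(2) using y0 by simp
  then have n0: "n \<ge> 1" by simp
  have V: "finite V" "V \<noteq> {}" "card V = n" using n0 by (auto simp: V_def)
  have Sym: "Sym n k = perms_cycles V k" unfolding V_def by (rule Sym_eq_perms_cycles)
  have finF: "finite F" using F(1) finite_Sym finite_subset by blast
  have gU: "g \<sigma> \<subseteq> V \<times> V" "card (g \<sigma>) \<le> n" if "\<sigma> \<in> F" for \<sigma>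
  proof -
    have "matching V (g \<sigma>)" unfolding g_def using F(1) that Sym by (intro matching_gr) (auto simp: perms_cycles_def)
    then show "g \<sigma> \<subseteq> V \<times> V" "card (g \<sigma>) \<le> n" using card_matching_le[of V "g \<sigma>"] V by (auto simp: matching_def)
  qed
  have inter: "g \<sigma> \<inter> g \<tau> \<noteq> {}" if "\<sigma> \<in> F" "\<tau> \<in> F" for \<sigma> \<tau>
  proof -
    have "\<exists>i\<in>V. \<sigma> i = \<tau> i" using F(2) that by (simp only: intersecting_def V_def)
    then obtain i where "i \<in> V" "\<sigma> i = \<tau> i" ..
    then have "(i, \<sigma> i) \<in> g \<sigma> \<inter> g \<tau>" by (auto simp: g_def gr_def)
    then show ?thesis by blast
  qed
  have cnk: "real (stirling n k) \<le> y ^ 8 * M"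
  proof -
    have "real (stirling n k) \<le> real (n * max (stirling (n - 1) k) (stirling (n - 1) (k - 1)))"
      using stirling_le_max[OF n0 k(1)] by (simp only: of_nat_le_iff)
    then show ?thesis by (simp only: of_nat_mult M_def y(2))
  qed
  have kn: "6 * real k / real n \<le> 6 / y ^ 6"
  proof -
    have "6 * real k / real n \<le> 6 * y ^ 2 / y ^ 8"
      unfolding y(2) using k y0 by (intro divide_right_mono) auto
    also have "\<dots> = 6 / y ^ 6" using y0 by (simp add: field_simps eval_nat_numeral)
    finally show ?thesis .
  qed
  have N: "real (card {\<sigma> \<in> F. X \<subseteq> g \<sigma>}) \<le> y ^ 8 * M * (6 / y ^ 6) ^ card X" if "finite X" for X
  proof -
    have "card {\<sigma> \<in> F. X \<subseteq> g \<sigma>} \<le> card {\<sigma> \<in> perms_cycles V k. X \<subseteq> gr V \<sigma>}"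
      using F(1) Sym finite_perms_cycles[OF V(1), of k] by (intro card_mono) (auto simp: g_def)
    then have "real (card {\<sigma> \<in> F. X \<subseteq> g \<sigma>}) \<le> real (card {\<sigma> \<in> perms_cycles V k. X \<subseteq> gr V \<sigma>})"
      by simp
    also have "\<dots> \<le> stirling n k * (6 * real k / real n) ^ card X"
      using card_containing_le[OF V(1,2) that k(1)] unfolding V(3) .
    also have "\<dots> \<le> y ^ 8 * M * (6 / y ^ 6) ^ card X"
      using cnk kn y0 M0 by (intro mult_mono power_mono) auto
    finally show ?thesis .
  qed
  have cancel: "a * (b / (a * a)) = b / a" if "a > 0" for a b :: real using that by simp
  have F': "real (card F') \<le> 6 ^ 16 / y ^ 8 * M"
  proof -
    have "F' = {} \<or> (\<exists>X\<subseteq>V \<times> V. 15 < card X \<and> real (card F') \<le> (y ^ 5) ^ card X * card {\<sigma> \<in> F'. X \<subseteq> g \<sigma>})"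
      unfolding F'_def S_def
      by (rule spread_approximation) (use V gU finF y0 in auto)
    then show ?thesis
    proof
      assume "\<exists>X\<subseteq>V \<times> V. 15 < card X \<and> real (card F') \<le> (y ^ 5) ^ card X * card {\<sigma> \<in> F'. X \<subseteq> g \<sigma>}"
      then obtain X where X: "X \<subseteq> V \<times> V" "15 < card X"
        and le: "real (card F') \<le> (y ^ 5) ^ card X * card {\<sigma> \<in> F'. X \<subseteq> g \<sigma>}" by blast
      have finX: "finite X" using X V finite_subset by blast
      have "real (card {\<sigma> \<in> F'. X \<subseteq> g \<sigma>}) \<le> real (card {\<sigma> \<in> F. X \<subseteq> g \<sigma>})"
        using finF by (intro of_nat_mono card_mono) (auto simp: F'_def)
      also have "\<dots> \<le> y ^ 8 * M * (6 / y ^ 6) ^ card X" by (rule N[OF finX])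
      finally have "real (card F') \<le> (y ^ 5) ^ card X * (y ^ 8 * M * (6 / y ^ 6) ^ card X)"
        using y0 by (intro order_trans[OF le] mult_left_mono) auto
      also have "\<dots> = y ^ 8 * M * (y ^ 5 * (6 / y ^ 6)) ^ card X"
        by (simp only: power_mult_distrib mult_ac)
      also have "y ^ 5 * (6 / y ^ 6) = 6 / y" using y0 by (simp add: field_simps eval_nat_numeral)
      \<comment> \<open>Since \<open>6 / y\<close> is below 1 and \<open>X\<close> has at least 16
        elements, the exponent can be lowered to 16.\<close>
      also have "y ^ 8 * M * (6 / y) ^ card X \<le> y ^ 8 * M * (6 / y) ^ 16"
        using X y y0 M0 by (intro mult_left_mono power_decreasing) auto
      also have "\<dots> = 6 ^ 16 / y ^ 8 * M"
      proof -
        have e: "y ^ 16 = y ^ 8 * y ^ 8" by (simp flip: power_add)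
        have "y ^ 8 * (6 / y) ^ 16 = 6 ^ 16 / y ^ 8"
          unfolding power_divide e using y0 by (intro cancel) simp
        then show ?thesis by (simp only: mult_ac)
      qed
      finally show ?thesis .
    qed (use M0 y0 in simp)
  qed
  have Sfin: "finite X \<and> card X \<le> 15" if "X \<in> S" for X using that by (auto simp: S_def spread_cores_def)
  have Sint: "X \<inter> Y \<noteq> {}" if "X \<in> S" "Y \<in> S" for X Y
  proof -
    have "y ^ 1 \<le> y ^ 5" using y by (intro power_increasing) auto
    then show ?thesis
      using that unfolding S_def
      by (intro spread_cores_intersect[where U = "V \<times> V", OF _ _ finF inter _ _ fragment_tail[OF y]])
        (use gU V y y0 in auto)
  qed
  have goal: ?thesis if "real (card F) \<le> real (card F') + (2 / 3 + 8100 / y ^ 4) * M"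
    using that F' unfolding M_def[symmetric] by (simp add: algebra_simps)
  have F_split: "F \<subseteq> F' \<union> {\<sigma> \<in> F. \<exists>X\<in>S. X \<subseteq> g \<sigma>}" by (auto simp: F'_def)
  have finF': "finite F'" using finF by (simp add: F'_def)
  show ?thesis
  proof (cases "\<forall>x. \<exists>X\<in>S. x \<notin> X")
    case True
    then have nc: "\<exists>X\<in>S. x \<notin> X" for x ..
    obtain P where P: "finite P" "card P \<le> 15 * 15" "\<And>x y. (x, y) \<in> P \<Longrightarrow> x \<noteq> y"
      "\<And>X. X \<in> S \<Longrightarrow> \<exists>(x, y)\<in>P. x \<in> X \<and> y \<in> X"
      by (rule intersecting_pairs[OF Sint Sfin nc]) (assumption | rule that)+
    have "{\<sigma> \<in> F. \<exists>X\<in>S. X \<subseteq> g \<sigma>} \<subseteq> (\<Union>(u, v)\<in>P. {\<sigma> \<in> F. {u, v} \<subseteq> g \<sigma>})"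
    proof
      fix \<sigma> assume "\<sigma> \<in> {\<sigma> \<in> F. \<exists>X\<in>S. X \<subseteq> g \<sigma>}"
      then obtain X where X: "\<sigma> \<in> F" "X \<in> S" "X \<subseteq> g \<sigma>" by blast
      obtain u v where "(u, v) \<in> P" "u \<in> X" "v \<in> X" using P(4)[OF X(2)] by blast
      then show "\<sigma> \<in> (\<Union>(u, v)\<in>P. {\<sigma> \<in> F. {u, v} \<subseteq> g \<sigma>})" using X by (intro UN_I[of "(u, v)"]) auto
    qed
    then have "card {\<sigma> \<in> F. \<exists>X\<in>S. X \<subseteq> g \<sigma>} \<le> card (\<Union>(u, v)\<in>P. {\<sigma> \<in> F. {u, v} \<subseteq> g \<sigma>})"
      using finF P(1) by (intro card_mono) auto
    also have "\<dots> \<le> (\<Sum>p\<in>P. card (case p of (u, v) \<Rightarrow> {\<sigma> \<in> F. {u, v} \<subseteq> g \<sigma>}))" by (rule card_UN_le[OF P(1)])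
    finally have "real (card {\<sigma> \<in> F. \<exists>X\<in>S. X \<subseteq> g \<sigma>}) \<le> (\<Sum>p\<in>P. real (card (case p of (u, v) \<Rightarrow> {\<sigma> \<in> F. {u, v} \<subseteq> g \<sigma>})))"
      by (simp flip: of_nat_sum)
    also have "\<dots> \<le> (\<Sum>p\<in>P. 36 / y ^ 4 * M)"
    proof (rule sum_mono)
      fix p assume p: "p \<in> P"
      obtain u v where uv: "p = (u, v)" by (cases p)
      then have "u \<noteq> v" using p P(3) by blast
      then have "card {u, v} = 2" by simp
      then have "real (card {\<sigma> \<in> F. {u, v} \<subseteq> g \<sigma>}) \<le> y ^ 8 * M * (6 / y ^ 6) ^ 2"
        using N[of "{u, v}"] by (simp only: finite.intros)
      also have "\<dots> = 36 / y ^ 4 * M" using y0 by (simp add: field_simps eval_nat_numeral)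
      finally show "real (card (case p of (u, v) \<Rightarrow> {\<sigma> \<in> F. {u, v} \<subseteq> g \<sigma>})) \<le> 36 / y ^ 4 * M"
        using uv by simp
    qed
    also have "\<dots> = real (card P) * (36 / y ^ 4 * M)" by simp
    \<comment> \<open>There are at most \<open>15 * 15 = 225\<close> pairs, each costing
      \<open>36 / y ^ 4\<close>; hence the constant 8100.\<close>
    also have "\<dots> \<le> 225 * (36 / y ^ 4 * M)" using P(2) M0 y0 by (intro mult_right_mono) auto
    also have "\<dots> \<le> (2 / 3 + 8100 / y ^ 4) * M" using M0 by (simp add: algebra_simps)
    finally have 1: "real (card {\<sigma> \<in> F. \<exists>X\<in>S. X \<subseteq> g \<sigma>}) \<le> (2 / 3 + 8100 / y ^ 4) * M" .
    have "card F \<le> card (F' \<union> {\<sigma> \<in> F. \<exists>X\<in>S. X \<subseteq> g \<sigma>})" using F_split finF finF' by (intro card_mono) auto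
    also have "\<dots> \<le> card F' + card {\<sigma> \<in> F. \<exists>X\<in>S. X \<subseteq> g \<sigma>}" by (rule card_Un_le)
    finally show ?thesis using 1 by (intro goal) linarith
  next
    case False
    then obtain i j where ij: "\<And>X. X \<in> S \<Longrightarrow> (i, j) \<in> X" by (metis surj_pair)
    show ?thesis
    \<comment> \<open>If there are no cores, \<open>(i, j)\<close> is arbitrary and may lie outside
      \<open>V \<times> V\<close>, but then \<open>F \<subseteq> F'\<close>.\<close>
    proof (cases "F \<subseteq> F'")
      case True
      then have "card F \<le> card F'" using finF' by (intro card_mono)
      then show ?thesis using M0 y0 by (intro goal) (simp add: add_increasing2)
    next
      case False
      then obtain \<sigma> X where s: "\<sigma> \<in> F" "X \<in> S" "X \<subseteq> g \<sigma>" by (auto simp: F'_def)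
      then have "(i, j) \<in> V \<times> V" using ij[OF s(2)] gU(1)[OF s(1)] by auto
      then have ijV: "i \<in> V" "j \<in> V" by auto
      have "centred n k F" if "F \<subseteq> star n k i j"
        unfolding centred_def using ijV that unfolding V_def by (intro bexI)
      then have "\<not> F \<subseteq> star n k i j" using F(3) by argo
      \<comment> \<open>This is where non-centredness enters: every member of \<open>F\<close>
        sending \<open>i\<close> to \<open>j\<close> has to agree somewhere with this one
        \<open>\<tau>\<close>.\<close>
      then obtain \<tau> where \<tau>: "\<tau> \<in> F" "\<tau> i \<noteq> j" using F(1) by (auto simp: star_def)
      let ?A = "{\<sigma> \<in> perms_cycles V k. \<sigma> i = j \<and> gr V \<tau> \<inter> gr V \<sigma> \<noteq> {}}"
      have ny: "y ^ 4 \<ge> 200 ^ 4" using y by (intro power_mono) auto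
      have yy: "y ^ 8 = y ^ 4 * y ^ 4" "y ^ 4 = y ^ 2 * y ^ 2" by (simp_all flip: power_add)
      have n_big: "real n \<ge> 200 ^ 8" unfolding y(2) using y by (intro power_mono) auto
      have h1: "1 / (real n - 5) \<le> 2 / y ^ 8" "1 / (real n - 4) \<le> 2 / y ^ 8"
        using n_big y0 unfolding y(2) by (simp_all add: field_simps)
      have k1: "real k \<ge> 1" using k by simp
      have y2: "y ^ 2 \<ge> 1" using k k1 by linarith
      have kk: "(real k + 4) * real k \<le> 5 * y ^ 4"
      proof -
        have "(real k + 4) * real k \<le> (5 * y ^ 2) * y ^ 2"
          using k k1 y2 by (intro mult_mono) linarith+
        then show ?thesis unfolding yy(2) by (simp only: mult.assoc)
      qed
      have k4: "real k + 4 \<le> 5 * y ^ 4" "real k \<le> y ^ 4"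
      proof -
        have "y ^ 2 * 1 \<le> y ^ 2 * y ^ 2" using y2 by (intro mult_left_mono) auto
        then show "real k \<le> y ^ 4" using k(2) unfolding yy(2) by linarith
        then show "real k + 4 \<le> 5 * y ^ 4" using k1 ny by linarith
      qed
      have y84: "y ^ 4 * (2 / y ^ 8) = 2 / y ^ 4" unfolding yy(1) using y0 by (intro cancel) simp
      have y84': "2 / y ^ 8 \<le> 2 / y ^ 4"
        using y by (intro divide_left_mono power_increasing) auto
      \<comment> \<open>The error \<open>12 / y ^ 4\<close> has a part \<open>10 / y ^ 4\<close>
        from the term with \<open>k + 4\<close> and a part \<open>2 / y ^ 4\<close> from the other
        term, in both estimates.\<close>
      have e1: "1 / (real n - 5) + (real k + 4) * real k / (real n - 4) \<le> 12 / y ^ 4"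
      proof -
        have "(real k + 4) * real k * (1 / (real n - 4)) \<le> 5 * y ^ 4 * (2 / y ^ 8)"
          by (rule mult_mono[OF kk h1(2)]) (use n_big y0 in auto)
        then show ?thesis using h1(1) y84 y84' by (simp add: mult.assoc)
      qed
      have e2: "(real k + 4) / (real n - 5) + real k / (real n - 4) \<le> 12 / y ^ 4"
      proof -
        have "(real k + 4) * (1 / (real n - 5)) \<le> 5 * y ^ 4 * (2 / y ^ 8)"
          by (rule mult_mono[OF k4(1) h1(1)]) (use n_big y0 in auto)
        moreover have "real k * (1 / (real n - 4)) \<le> y ^ 4 * (2 / y ^ 8)"
          by (rule mult_mono[OF k4(2) h1(2)]) (use n_big y0 in auto)
        ultimately show ?thesis using y84 by (simp add: mult.assoc)
      qed
      have "real (card ?A) \<le> (2 / 3 + 3 * (12 / y ^ 4)) * stirling (card V - 1) (if i = j then k - 1 else k)"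
      proof (rule card_star_meeting_le)
        show "12 / y ^ 4 \<le> 1" using ny y0 by simp
        show "6 \<le> card V" using n_big V(3) by simp
        show "\<tau> \<in> perms_cycles V k" using \<tau> F(1) Sym by auto
        show "1 / (real (card V) - 5) + (real k + 4) * real k / (real (card V) - 4) \<le> 12 / y ^ 4"
          "(real k + 4) / (real (card V) - 5) + real k / (real (card V) - 4) \<le> 12 / y ^ 4"
          unfolding V(3) by (fact e1, fact e2)
      qed (use V ijV k \<tau> in auto)
      also have "\<dots> \<le> (2 / 3 + 3 * (12 / y ^ 4)) * M"
        using y0 V(3) unfolding M_def by (intro mult_left_mono) auto
      also have "\<dots> \<le> (2 / 3 + 8100 / y ^ 4) * M"
        using y0 M0 by (intro mult_right_mono add_mono) (auto simp: field_simps)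
      finally have 1: "real (card ?A) \<le> (2 / 3 + 8100 / y ^ 4) * M" .
      \<comment> \<open>A member outside \<open>F'\<close> contains a core, hence the common pair
        \<open>(i, j)\<close>, and it meets \<open>\<tau>\<close> because \<open>F\<close> is
        intersecting.\<close>
      have "F \<subseteq> F' \<union> ?A"
      proof
        fix \<sigma> assume s: "\<sigma> \<in> F"
        show "\<sigma> \<in> F' \<union> ?A"
        proof (cases "\<sigma> \<in> F'")
          case False
          then obtain X where "X \<in> S" "X \<subseteq> g \<sigma>" using s by (auto simp: F'_def)
          then have "(i, j) \<in> g \<sigma>" using ij by blast
          then have "\<sigma> i = j" by (auto simp: g_def gr_def)
          then show ?thesis using inter[OF \<tau>(1) s] s F(1) Sym by (auto simp: g_def)
        qed simp
      qed
      then have "card F \<le> card (F' \<union> ?A)"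
        using finF' finite_perms_cycles[OF V(1), of k] by (intro card_mono) auto
      also have "\<dots> \<le> card F' + card ?A" by (rule card_Un_le)
      finally show ?thesis using 1 by (intro goal) linarith
    qed
  qed
qed

theorem theorem1p2:
  shows "\<forall>\<xi>::real. \<xi> > 0 \<longrightarrow> (\<exists>N::nat. \<forall>n\<ge>N. \<forall>k::nat.
    1 \<le> k \<and> real k \<le> real n powr (1 / 4) \<longrightarrow>
    (\<forall>\<F>. \<F> \<subseteq> Sym n k \<and> intersecting n \<F> \<and> \<not> centred n k \<F> \<longrightarrow>
      real (card \<F>) \<le> (2 / 3 + \<xi>) * real (max (stirling (n - 1) k) (stirling (n - 1) (k - 1)))))"
proof (intro allI impI)
  fix \<xi> :: real assume \<xi>: "\<xi> > 0"
  \<comment> \<open>The value 200 is what \<open>fragment_tail\<close> asks of \<open>y\<close>; the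
    quotient makes the total error, at most \<open>(8100 + 6 ^ 16) / y\<close>, no larger than
    \<open>\<xi>\<close>.\<close>
  define Y where "Y = max 200 ((8100 + 6 ^ 16) / \<xi>)"
  show "\<exists>N::nat. \<forall>n\<ge>N. \<forall>k::nat.
    1 \<le> k \<and> real k \<le> real n powr (1 / 4) \<longrightarrow>
    (\<forall>\<F>. \<F> \<subseteq> Sym n k \<and> intersecting n \<F> \<and> \<not> centred n k \<F> \<longrightarrow>
      real (card \<F>) \<le> (2 / 3 + \<xi>) * real (max (stirling (n - 1) k) (stirling (n - 1) (k - 1))))"
  proof (intro exI[of _ "nat \<lceil>Y ^ 8\<rceil>"] allI impI, elim conjE)
    fix n k :: nat and F
    assume n: "n \<ge> nat \<lceil>Y ^ 8\<rceil>" and k: "1 \<le> k" "real k \<le> real n powr (1 / 4)"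
      and F: "F \<subseteq> Sym n k" "intersecting n F" "\<not> centred n k F"
    define y where "y = real n powr (1 / 8)"
    have Y: "Y \<ge> 200" "(8100 + 6 ^ 16) / \<xi> \<le> Y" by (auto simp: Y_def)
    have nY: "real n \<ge> Y ^ 8" using n by linarith
    then have n0: "real n > 0" using Y by (smt (verit) zero_less_power)
    have y8: "y ^ 8 = real n" unfolding y_def using n0 by (simp add: powr_powr flip: powr_realpow)
    have y2: "y ^ 2 = real n powr (1 / 4)" unfolding y_def using n0 by (simp add: powr_powr flip: powr_realpow)
    have yY: "y \<ge> Y"
    proof (rule power_le_imp_le_base)
      show "Y ^ Suc 7 \<le> y ^ Suc 7" using nY y8 by simp
    qed (simp add: y_def)
    then have y: "y \<ge> 200" "y \<ge> 1" "y > 0" using Y by auto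
    have "8100 / y ^ 4 + 6 ^ 16 / y ^ 8 \<le> 8100 / y + 6 ^ 16 / y"
      using y power_increasing[of 1 4 y] power_increasing[of 1 8 y]
      by (intro add_mono divide_left_mono) auto
    also have "\<dots> = (8100 + 6 ^ 16) / y" by (simp add: add_divide_distrib)
    also have "\<dots> \<le> \<xi>"
      using order_trans[OF Y(2) yY] \<xi> y by (simp add: field_simps)
    finally have e: "8100 / y ^ 4 + 6 ^ 16 / y ^ 8 \<le> \<xi>" .
    have "real (card F) \<le> (2 / 3 + (8100 / y ^ 4 + 6 ^ 16 / y ^ 8)) * real (max (stirling (n - 1) k) (stirling (n - 1) (k - 1)))"
      using card_non_centred_le[OF y(1) y8[symmetric] k(1) _ F] k(2) y2 by simp
    also have "\<dots> \<le> (2 / 3 + \<xi>) * real (max (stirling (n - 1) k) (stirling (n - 1) (k - 1)))"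
      using e by (intro mult_right_mono) auto
    finally show "real (card F) \<le> (2 / 3 + \<xi>) * real (max (stirling (n - 1) k) (stirling (n - 1) (k - 1)))" .
  qed
qed

end
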